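(* For every $n\ge1$, $$\mathcal P^{\mathrm{BM}}_{\mathbb R^n\setminus\{0\}}(t)=t^n+t.$$ This agrees with the polar factorization $\mathbb R^n\setminus\{0\}\cong S^{n-1}\times(0,\infty)$ at the Borel–Moore homology level: $$t^n+t=t(1+t^{n-1}).$$
   Context: For a locally compact Hausdorff, locally contractible space $X$, $H_*^{\mathrm{BM}}(X)$ denotes Borel–Moore homology, i.e. homology of locally finite singular chains (for the spaces here it is computed by the homology of the one-point compactification relative to the added point). When the groups have finite rank, $\mathcal P_X^{\mathrm{BM}}(t)=\sum_i\operatorname{rank}H_i^{\mathrm{BM}}(X;\mathbb Z)\,t^i$. In the polar factorization, $1+t^{n-1}$ is the Poincaré polynomial of $S^{n-1}$ (equal to $2$ for $n=1$) and $t=\mathcal P^{\mathrm{BM}}_{(0,\infty)}(t)$. *)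

theory Defs
  imports "HOL-Homology.Homology" "HOL-Library.Extended_Nat" "HOL-Computational_Algebra.Formal_Power_Series"
begin

text \<open>Groups are written multiplicatively, as in HOL-Algebra: an integer linear combination of the
  elements of \<open>S\<close> is a product of integer powers.\<close>

definition Z_independent :: "('a, 'b) monoid_scheme \<Rightarrow> 'a set \<Rightarrow> bool" where
  "Z_independent G S \<longleftrightarrow> finite S \<and> S \<subseteq> carrier G \<and>
     (\<forall>a :: 'a \<Rightarrow> int. (\<Otimes>\<^bsub>G\<^esub>x\<in>S. x [^]\<^bsub>G\<^esub> a x) = \<one>\<^bsub>G\<^esub> \<longrightarrow> (\<forall>x\<in>S. a x = 0))"

definition group_rank :: "('a, 'b) monoid_scheme \<Rightarrow> enat" where
  "group_rank G = (SUP S\<in>{S. Z_independent G S}. enat (card S))"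

text \<open>A locally finite chain is an arbitrary family of integer coefficients, such that every point has
  a neighbourhood meeting the images of only finitely many simplices with nonzero coefficient.
  In a locally compact space this says that every compact set meets only finitely many of them.\<close>

definition lf_chain_set :: "nat \<Rightarrow> 'a topology \<Rightarrow> (((nat \<Rightarrow> real) \<Rightarrow> 'a) \<Rightarrow> int) set" where
  "lf_chain_set p X = {c. (\<forall>f. c f \<noteq> 0 \<longrightarrow> singular_simplex p X f) \<and>
     (\<forall>x\<in>topspace X. \<exists>U. openin X U \<and> x \<in> U \<and>
        finite {f. c f \<noteq> 0 \<and> f ` standard_simplex p \<inter> U \<noteq> {}})}"

text \<open>The boundary is the linear extension of the singular boundary of a single simplex. On a locally
  finite chain the index set below is finite: all simplices in it pass through the image of \<open>g\<close>,
  which is compact.\<close>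

definition lf_boundary ::
    "nat \<Rightarrow> (((nat \<Rightarrow> real) \<Rightarrow> 'a) \<Rightarrow> int) \<Rightarrow> ((nat \<Rightarrow> real) \<Rightarrow> 'a) \<Rightarrow> int" where
  "lf_boundary p c = (\<lambda>g. \<Sum>f | c f \<noteq> 0 \<and> g \<in> Poly_Mapping.keys (chain_boundary p (frag_of f)).
     c f * Poly_Mapping.lookup (chain_boundary p (frag_of f)) g)"

lemma lf_boundary_finite_chain:
  "lf_boundary p (Poly_Mapping.lookup c) = Poly_Mapping.lookup (chain_boundary p c)"
proof
  fix g
  have lin: "Poly_Mapping.lookup (sum h A) g = (\<Sum>f\<in>A. Poly_Mapping.lookup (h f) g)" if "finite A"
    for h :: "((nat \<Rightarrow> real) \<Rightarrow> 'a) \<Rightarrow> 'a chain" and A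
    using that by (induction A rule: finite_induct) (auto simp: lookup_add)
  have "chain_boundary p c =
      (\<Sum>f\<in>Poly_Mapping.keys c. frag_cmul (Poly_Mapping.lookup c f) (chain_boundary p (frag_of f)))"
    by (simp add: chain_boundary_def frag_extend_def)
  then have "Poly_Mapping.lookup (chain_boundary p c) g = (\<Sum>f\<in>Poly_Mapping.keys c.
      Poly_Mapping.lookup c f * Poly_Mapping.lookup (chain_boundary p (frag_of f)) g)"
    by (simp add: lin)
  also have "\<dots> = lf_boundary p (Poly_Mapping.lookup c) g"
    unfolding lf_boundary_def
    by (intro sum.mono_neutral_right) (auto simp: in_keys_iff)
  finally show "lf_boundary p (Poly_Mapping.lookup c) g = Poly_Mapping.lookup (chain_boundary p c) g"
    by simp
qed

definition lf_cycle_group :: "nat \<Rightarrow> 'a topology \<Rightarrow> (((nat \<Rightarrow> real) \<Rightarrow> 'a) \<Rightarrow> int) monoid" where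
  "lf_cycle_group p X = \<lparr>carrier = {c \<in> lf_chain_set p X. lf_boundary p c = (\<lambda>g. 0)},
     monoid.mult = (\<lambda>c d f. c f + d f), one = (\<lambda>f. 0)\<rparr>"

definition BM_homology_group ::
    "nat \<Rightarrow> 'a topology \<Rightarrow> (((nat \<Rightarrow> real) \<Rightarrow> 'a) \<Rightarrow> int) set monoid" where
  "BM_homology_group p X = lf_cycle_group p X Mod (lf_boundary (Suc p) ` lf_chain_set (Suc p) X)"

text \<open>The generating function of the ranks is a formal power series, so that no assumption of vanishing
  in high degrees is built in. It is meaningful when all ranks are finite, which is recorded by the
  separate predicates.\<close>

definition finite_BM_ranks :: "'a topology \<Rightarrow> bool" where
  "finite_BM_ranks X \<longleftrightarrow> (\<forall>i. group_rank (BM_homology_group i X) \<noteq> \<infinity>)"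

definition BM_poincare :: "'a topology \<Rightarrow> int fps" where
  "BM_poincare X = Abs_fps (\<lambda>i. int (the_enat (group_rank (BM_homology_group i X))))"

definition finite_homology_ranks :: "'a topology \<Rightarrow> bool" where
  "finite_homology_ranks X \<longleftrightarrow> (\<forall>i. group_rank (homology_group (int i) X) \<noteq> \<infinity>)"

definition poincare :: "'a topology \<Rightarrow> int fps" where
  "poincare X = Abs_fps (\<lambda>i. int (the_enat (group_rank (homology_group (int i) X))))"

definition punctured_space :: "nat \<Rightarrow> (nat \<Rightarrow> real) topology" where
  "punctured_space n = subtopology (Euclidean_space n) (- {\<lambda>i. 0})"

definition positive_ray :: "real topology" where
  "positive_ray = subtopology euclideanreal {0<..}"

end

theory Submission
  imports Defs
begin

text \<open>
  Let \<open>Y\<close> be compact. The idea is that \<open>H_p^{BM}(Y \<times> (0,\<infinity>)) \<cong> H_{p-1}(Y)\<close>, so that the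
  Borel-Moore Poincare series of \<open>Y \<times> (0,\<infinity>)\<close> is \<open>t\<close> times the Poincare series of \<open>Y\<close>
  (\<open>BM_poincare_ray_product\<close>). For \<open>Y\<close> a point this is the series \<open>t\<close> of the ray. For
  \<open>Y = S^{n-1}\<close> polar coordinates (\<open>polar_homeomorphism\<close>) identify the product with the punctured
  space, and the series \<open>1 + t^{n-1}\<close> of the sphere turns into \<open>t + t^n\<close>. Since both series are
  computed by the same theorem, the factorization is automatic.

  The isomorphism has two parts. The first turns locally finite homology into ordinary relative
  homology. Let compact sets \<open>K_0 \<subseteq> K_1 \<subseteq> \<dots>\<close> exhaust \<open>X\<close>. A locally finite chain has only
  finitely many simplices meeting \<open>K_k\<close>, and every simplex meets some \<open>K_k\<close>; hence the complex of
  locally finite chains is the inverse limit of the complexes \<open>C(X) / C(X - K_k)\<close>. If all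
  the maps \<open>H(X, X - K_{k+1}) \<rightarrow> H(X, X - K_k)\<close> are bijective, cycles and bounding chains can be
  lifted step by step through this tower, and \<open>H_p^{BM}(X) \<cong> H_p(X, X - K_0)\<close>
  (\<open>BM_homology_iso_relative\<close>).

  The second part is the computation of these relative groups for \<open>X = Y \<times> \<real>\<close> with
  \<open>K_k = Y \<times> [-(k+1), k+1]\<close>. Stretching the line shows that the tower is constant
  (\<open>cylinder_ends_inclusion_iso\<close>), and the exact sequence of a triple together with excision cuts
  off one of the two ends and leaves \<open>H_{p-1}\<close> of the other one, which is homotopy equivalent to \<open>Y\<close>
  (\<open>relative_homology_cylinder_ends\<close>).
\<close>

section \<open>Ranks of abelian groups\<close>

text \<open>Fraction-free Gaussian elimination, one coordinate at a time, so that all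
  coefficients stay integers.\<close>

lemma integer_relation_exists:
  fixes v :: "'t \<Rightarrow> 's \<Rightarrow> int"
  assumes "finite S" "finite T" "card S < card T"
  shows "\<exists>a. (\<exists>t\<in>T. a t \<noteq> 0) \<and> (\<forall>s\<in>S. (\<Sum>t\<in>T. a t * v t s) = 0)"
  using assms
proof (induction S arbitrary: T v rule: finite_induct)
  case empty
  then have "T \<noteq> {}" by auto
  then show ?case by (intro exI[of _ "\<lambda>t. 1"]) auto
next
  case (insert s S)
  show ?case
  proof (cases "\<forall>t\<in>T. v t s = 0")
    case True
    have "card S < card T" using insert by simp
    then obtain a where "\<exists>t\<in>T. a t \<noteq> 0" "\<forall>r\<in>S. (\<Sum>t\<in>T. a t * v t r) = 0"
      using insert.IH[OF insert.prems(1), of v] by (elim meta_impE exE conjE)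
    then show ?thesis using True by (intro exI[of _ a]) simp
  next
    case False
    then obtain u where u: "u \<in> T" "v u s \<noteq> 0" by blast
    \<comment> \<open>The row \<open>u\<close> serves as pivot in column \<open>s\<close>: every other row \<open>t\<close> is replaced by
      \<open>v u s\<close> times row \<open>t\<close> minus \<open>v t s\<close> times row \<open>u\<close>, which vanishes in that column.\<close>
    let ?T = "T - {u}"
    have T: "finite ?T" "card S < card ?T" using insert u by auto
    obtain a where a: "\<exists>t\<in>?T. a t \<noteq> 0" "\<forall>r\<in>S. (\<Sum>t\<in>?T. a t * (v u s * v t r - v t s * v u r)) = 0"
      using insert.IH[OF T, of "\<lambda>t r. v u s * v t r - v t s * v u r"] by (elim exE conjE)
    \<comment> \<open>The coefficients of the relation between the reduced rows, rewritten in terms of the rows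
      themselves.\<close>
    define b where "b t = (if t = u then - (\<Sum>t\<in>?T. a t * v t s) else a t * v u s)" for t
    have "(\<Sum>t\<in>T. b t * v t r) = (\<Sum>t\<in>?T. a t * (v u s * v t r - v t s * v u r))" for r
    proof -
      have "(\<Sum>t\<in>T. b t * v t r) = b u * v u r + (\<Sum>t\<in>?T. b t * v t r)"
        by (rule sum.remove[OF insert.prems(1) u(1)])
      also have "(\<Sum>t\<in>?T. b t * v t r) = (\<Sum>t\<in>?T. a t * v u s * v t r)"
        by (rule sum.cong) (simp_all add: b_def)
      also have "b u * v u r = - (\<Sum>t\<in>?T. a t * v t s * v u r)"
        by (simp add: b_def sum_distrib_right)
      also have "- (\<Sum>t\<in>?T. a t * v t s * v u r) + (\<Sum>t\<in>?T. a t * v u s * v t r)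
          = (\<Sum>t\<in>?T. a t * (v u s * v t r - v t s * v u r))"
        by (simp add: sum_subtractf algebra_simps)
      finally show ?thesis .
    qed
    moreover have "(\<Sum>t\<in>?T. a t * (v u s * v t s - v t s * v u s)) = 0"
      by (rule sum.neutral) simp
    ultimately have "\<forall>r\<in>insert s S. (\<Sum>t\<in>T. b t * v t r) = 0" using a(2) by simp
    moreover have "\<exists>t\<in>T. b t \<noteq> 0"
    proof -
      obtain t where "t \<in> ?T" "a t \<noteq> 0" using a(1) by blast
      then show ?thesis using u by (intro bexI[of _ t]) (simp_all add: b_def)
    qed
    ultimately show ?thesis by (intro exI[of _ b] conjI)
  qed
qed

lemma finprod_free_Abelian_group:
  assumes "finite A" "f ` A \<subseteq> carrier (free_Abelian_group S)"
  shows "(\<Otimes>\<^bsub>free_Abelian_group S\<^esub>x\<in>A. f x) = (\<Sum>x\<in>A. f x)"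
proof -
  interpret comm_group "free_Abelian_group S" by (rule abelian_free_Abelian_group)
  show ?thesis
    using assms
  proof (induction A rule: finite_induct)
    case (insert x A)
    then have "f \<in> A \<rightarrow> carrier (free_Abelian_group S)" "f x \<in> carrier (free_Abelian_group S)" by auto
    from finprod_insert[OF insert.hyps this] show ?case using insert by simp
  qed simp
qed

lemma lookup_sum: "finite A \<Longrightarrow> Poly_Mapping.lookup (sum f A) s = (\<Sum>x\<in>A. Poly_Mapping.lookup (f x) s)"
  by (induction A rule: finite_induct) (simp_all add: lookup_add)

text \<open>In a free abelian group a product of powers is a formal sum, so independence can be tested
  coordinatewise, as a homogeneous linear system.\<close>

lemma Z_independent_free_Abelian_group:
  assumes "A \<subseteq> carrier (free_Abelian_group S)" "finite A"
  shows "Z_independent (free_Abelian_group S) A \<longleftrightarrow>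
     (\<forall>a :: _ \<Rightarrow> int. (\<forall>s\<in>S. (\<Sum>x\<in>A. a x * Poly_Mapping.lookup x s) = 0) \<longrightarrow> (\<forall>x\<in>A. a x = 0))"
proof -
  have keys: "Poly_Mapping.keys x \<subseteq> S" if "x \<in> A" for x
    using subsetD[OF assms(1) that] by simp
  have "(\<Otimes>\<^bsub>free_Abelian_group S\<^esub>x\<in>A. x [^]\<^bsub>free_Abelian_group S\<^esub> a x) = \<one>\<^bsub>free_Abelian_group S\<^esub> \<longleftrightarrow>
      (\<forall>s\<in>S. (\<Sum>x\<in>A. a x * Poly_Mapping.lookup x s) = 0)" for a :: "_ \<Rightarrow> int"
  proof -
    let ?c = "\<Sum>x\<in>A. frag_cmul (a x) x"
    have im: "(\<lambda>x. x [^]\<^bsub>free_Abelian_group S\<^esub> a x) ` A \<subseteq> carrier (free_Abelian_group S)"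
      using assms by (intro image_subsetI group.int_pow_closed[OF group_free_Abelian_group]) blast
    have "(\<Otimes>\<^bsub>free_Abelian_group S\<^esub>x\<in>A. x [^]\<^bsub>free_Abelian_group S\<^esub> a x) = (\<Sum>x\<in>A. x [^]\<^bsub>free_Abelian_group S\<^esub> a x)"
      by (rule finprod_free_Abelian_group[OF assms(2) im])
    also have "\<dots> = ?c"
      using keys by (intro sum.cong) simp_all
    finally have 1: "(\<Otimes>\<^bsub>free_Abelian_group S\<^esub>x\<in>A. x [^]\<^bsub>free_Abelian_group S\<^esub> a x) = ?c" .
    have lk: "Poly_Mapping.lookup ?c s = (\<Sum>x\<in>A. a x * Poly_Mapping.lookup x s)" for s
      by (simp add: lookup_sum assms(2))
    have "(\<Sum>x\<in>A. a x * Poly_Mapping.lookup x s) = 0" if "s \<notin> S" for s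
    proof (intro sum.neutral ballI)
      fix x assume "x \<in> A"
      then have "s \<notin> Poly_Mapping.keys x" using keys that by blast
      then show "a x * Poly_Mapping.lookup x s = 0" by (simp add: in_keys_iff)
    qed
    then have "?c = 0 \<longleftrightarrow> (\<forall>s\<in>S. (\<Sum>x\<in>A. a x * Poly_Mapping.lookup x s) = 0)"
      unfolding poly_mapping_eq_iff fun_eq_iff lk by auto
    then show ?thesis unfolding 1 by simp
  qed
  then show ?thesis using assms unfolding Z_independent_def by simp
qed

text \<open>The basis shows that the rank is at least the size of \<open>S\<close>; a larger independent set would be a
  system with more unknowns than equations, which has a nonzero integer solution.\<close>

theorem group_rank_free_Abelian_group:
  assumes S: "finite S"
  shows "group_rank (free_Abelian_group S) = enat (card S)"
proof (rule antisym)
  show "group_rank (free_Abelian_group S) \<le> enat (card S)"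
    unfolding group_rank_def
  proof (rule SUP_least)
    fix T assume T: "T \<in> {T. Z_independent (free_Abelian_group S) T}"
    then have T': "T \<subseteq> carrier (free_Abelian_group S)" "finite T" by (simp_all add: Z_independent_def)
    then have ind: "\<And>a :: _ \<Rightarrow> int. \<forall>s\<in>S. (\<Sum>x\<in>T. a x * Poly_Mapping.lookup x s) = 0 \<Longrightarrow> \<forall>x\<in>T. a x = 0"
      using T unfolding mem_Collect_eq Z_independent_free_Abelian_group[OF T'] by simp
    have "card T \<le> card S"
    proof (rule ccontr)
      assume "\<not> card T \<le> card S"
      then have "card S < card T" by simp
      from integer_relation_exists[OF S T'(2) this, of Poly_Mapping.lookup]
      obtain a where "\<exists>t\<in>T. a t \<noteq> 0" "\<forall>s\<in>S. (\<Sum>t\<in>T. a t * Poly_Mapping.lookup t s) = 0"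
        by (elim exE conjE)
      then show False using ind[of a] by simp
    qed
    then show "enat (card T) \<le> enat (card S)" by simp
  qed
next
  let ?B = "frag_of ` S"
  have inj: "inj_on frag_of S" by (simp add: frag_of_eq inj_on_def)
  have "Z_independent (free_Abelian_group S) ?B"
  proof (subst Z_independent_free_Abelian_group)
    show "\<forall>a :: _ \<Rightarrow> int. (\<forall>s\<in>S. (\<Sum>x\<in>?B. a x * Poly_Mapping.lookup x s) = 0) \<longrightarrow> (\<forall>x\<in>?B. a x = 0)"
    proof (intro allI impI)
      fix a :: "('a \<Rightarrow>\<^sub>0 int) \<Rightarrow> int"
      assume a: "\<forall>s\<in>S. (\<Sum>x\<in>?B. a x * Poly_Mapping.lookup x s) = 0"
      have "(\<Sum>x\<in>?B. a x * Poly_Mapping.lookup x s) = a (frag_of s)" if "s \<in> S" for s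
      proof -
        have "(\<Sum>x\<in>?B. a x * Poly_Mapping.lookup x s) = (\<Sum>t\<in>S. a (frag_of t) * (if s = t then 1 else 0))"
          by (simp add: sum.reindex[OF inj] lookup_frag_of)
        also have "\<dots> = a (frag_of s)"
          using S that by (simp add: if_distrib[of "\<lambda>x. _ * x"] cong: if_cong)
        finally show ?thesis .
      qed
      then show "\<forall>x\<in>?B. a x = 0" using a by simp
    qed
  qed (use S in auto)
  then have "enat (card ?B) \<le> group_rank (free_Abelian_group S)"
    unfolding group_rank_def by (intro SUP_upper) simp
  then show "enat (card S) \<le> group_rank (free_Abelian_group S)"
    using card_image[OF inj] by simp
qed

lemma hom_finprod_comm_group:
  assumes G: "comm_group G" and H: "comm_group H" and h: "h \<in> hom G H"
    and "finite A" "f ` A \<subseteq> carrier G"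
  shows "h (\<Otimes>\<^bsub>G\<^esub>x\<in>A. f x) = (\<Otimes>\<^bsub>H\<^esub>x\<in>A. h (f x))"
proof -
  interpret G: comm_group G by (rule G)
  interpret H: comm_group H by (rule H)
  show ?thesis
    using assms(4,5)
  proof (induction A rule: finite_induct)
    case empty
    show ?case using hom_one[OF h] by simp
  next
    case (insert x A)
    have f: "f \<in> A \<rightarrow> carrier G" "f x \<in> carrier G" using insert.prems by auto
    have hf: "(\<lambda>x. h (f x)) \<in> A \<rightarrow> carrier H" "h (f x) \<in> carrier H" using f hom_carrier[OF h] by auto
    have "h (\<Otimes>\<^bsub>G\<^esub>y\<in>insert x A. f y) = h (f x) \<otimes>\<^bsub>H\<^esub> h (\<Otimes>\<^bsub>G\<^esub>y\<in>A. f y)"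
      unfolding G.finprod_insert[OF insert.hyps f] using f by (intro hom_mult[OF h]) simp_all
    also have "\<dots> = (\<Otimes>\<^bsub>H\<^esub>y\<in>insert x A. h (f y))"
      unfolding H.finprod_insert[OF insert.hyps hf] using insert by simp
    finally show ?case .
  qed
qed

lemma Z_independent_iso_image:
  assumes G: "comm_group G" and H: "comm_group H" and h: "h \<in> iso G H" and S: "Z_independent G S"
  shows "Z_independent H (h ` S)" "card (h ` S) = card S"
proof -
  interpret G: comm_group G by (rule G)
  interpret H: comm_group H by (rule H)
  have hom: "h \<in> hom G H" and bij: "bij_betw h (carrier G) (carrier H)" using h by (auto simp: iso_def)
  have SG: "S \<subseteq> carrier G" "finite S" using S by (auto simp: Z_independent_def)
  have inj: "inj_on h S" using bij SG inj_on_subset unfolding bij_betw_def by blast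
  show "card (h ` S) = card S" by (rule card_image[OF inj])
  have "\<forall>y\<in>h ` S. a y = 0"
    if a: "(\<Otimes>\<^bsub>H\<^esub>y\<in>h ` S. y [^]\<^bsub>H\<^esub> a y) = \<one>\<^bsub>H\<^esub>" for a :: "_ \<Rightarrow> int"
  proof -
    have hS: "h x \<in> carrier H" if "x \<in> S" for x using that SG hom_carrier[OF hom] by auto
    have "(\<Otimes>\<^bsub>H\<^esub>y\<in>h ` S. y [^]\<^bsub>H\<^esub> a y) = (\<Otimes>\<^bsub>H\<^esub>x\<in>S. h x [^]\<^bsub>H\<^esub> a (h x))"
      using hS by (intro H.finprod_reindex[OF _ inj]) (auto intro: H.int_pow_closed)
    also have "\<dots> = (\<Otimes>\<^bsub>H\<^esub>x\<in>S. h (x [^]\<^bsub>G\<^esub> a (h x)))"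
    proof (rule H.finprod_cong'[OF refl])
      show "h x [^]\<^bsub>H\<^esub> a (h x) = h (x [^]\<^bsub>G\<^esub> a (h x))" if "x \<in> S" for x
        using hom_int_pow[OF hom] SG that G.is_group H.is_group by (simp add: subsetD)
    next
      show "(\<lambda>x. h (x [^]\<^bsub>G\<^esub> a (h x))) \<in> S \<rightarrow> carrier H"
        using SG by (intro Pi_I hom_in_carrier[OF hom] G.int_pow_closed) blast
    qed
    also have "\<dots> = h (\<Otimes>\<^bsub>G\<^esub>x\<in>S. x [^]\<^bsub>G\<^esub> a (h x))"
      using SG G.int_pow_closed by (intro hom_finprod_comm_group[OF G H hom, symmetric]) auto
    finally have "h (\<Otimes>\<^bsub>G\<^esub>x\<in>S. x [^]\<^bsub>G\<^esub> a (h x)) = h \<one>\<^bsub>G\<^esub>"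
      using a hom_one[OF hom] by simp
    moreover have "(\<Otimes>\<^bsub>G\<^esub>x\<in>S. x [^]\<^bsub>G\<^esub> a (h x)) \<in> carrier G"
      using SG G.int_pow_closed by (intro G.finprod_closed) auto
    ultimately have "(\<Otimes>\<^bsub>G\<^esub>x\<in>S. x [^]\<^bsub>G\<^esub> a (h x)) = \<one>\<^bsub>G\<^esub>"
      using bij_betw_imp_inj_on[OF bij] G.one_closed by (metis inj_onD)
    then have "\<forall>x\<in>S. a (h x) = 0"
      using S unfolding Z_independent_def by (elim conjE allE[of _ "\<lambda>x. a (h x)"]) simp
    then show ?thesis by simp
  qed
  then show "Z_independent H (h ` S)"
    using SG image_mono[OF SG(1), of h] hom_carrier[OF hom] unfolding Z_independent_def by simp
qed

lemma group_rank_le_iso: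
  assumes G: "comm_group G" and H: "comm_group H" and "G \<cong> H"
  shows "group_rank G \<le> group_rank H"
proof -
  obtain h where h: "h \<in> iso G H" using \<open>G \<cong> H\<close> by (auto simp: is_iso_def)
  show ?thesis
    unfolding group_rank_def
  proof (rule SUP_mono)
    show "\<exists>T\<in>{T. Z_independent H T}. enat (card S) \<le> enat (card T)" if "S \<in> {S. Z_independent G S}" for S
      using Z_independent_iso_image[OF G H h] that by (intro bexI[of _ "h ` S"]) simp_all
  qed
qed

lemma group_rank_iso:
  assumes G: "comm_group G" and H: "comm_group H" and "G \<cong> H"
  shows "group_rank G = group_rank H"
  using group_rank_le_iso[OF G H \<open>G \<cong> H\<close>]
    group_rank_le_iso[OF H G group.iso_sym[OF comm_group.axioms(2)[OF G] \<open>G \<cong> H\<close>]]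
  by (rule antisym)

section \<open>Homology of a point and of spheres\<close>

lemma group_rank_integer:
  assumes "comm_group G" "G \<cong> integer_group"
  shows "group_rank G = 1"
proof -
  have "G \<cong> free_Abelian_group {()}"
    using assms(2) isomorphic_group_integer_free_Abelian_group_singleton by (rule iso_trans)
  from group_rank_iso[OF assms(1) abelian_free_Abelian_group this] show ?thesis
    by (simp add: group_rank_free_Abelian_group one_enat_def)
qed

lemma group_rank_trivial:
  assumes "comm_group G" "trivial_group G"
  shows "group_rank G = 0"
proof -
  have "(\<lambda>x. 0) \<in> iso G (free_Abelian_group ({} :: unit set))"
    using assms(2) by (simp add: iso_def hom_def bij_betw_def trivial_group_def free_Abelian_group_def)
  then have "G \<cong> free_Abelian_group ({} :: unit set)"
    by (rule is_isoI)
  from group_rank_iso[OF assms(1) abelian_free_Abelian_group this] show ?thesis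
    by (simp add: group_rank_free_Abelian_group zero_enat_def)
qed

lemma group_rank_homology_point:
  "group_rank (homology_group (int i) (discrete_topology {a})) = (if i = 0 then 1 else 0)"
proof (cases "i = 0")
  case True
  then show ?thesis using homology_coefficients[of "discrete_topology {a}" a]
    by (simp add: group_rank_integer)
next
  case False
  then show ?thesis using homology_dimension_axiom[of "discrete_topology {a}" a "int i"]
    by (simp add: group_rank_trivial)
qed

text \<open>The coordinate \<open>x 0\<close> takes only the values \<open>1\<close> and \<open>-1\<close> on the zero-dimensional sphere, so a
  connected subset cannot contain both points.\<close>

lemma path_components_nsphere_0: "card (path_components_of (nsphere 0)) = 2"
proof -
  have top: "x \<in> topspace (nsphere 0) \<longleftrightarrow> x 0 \<in> {1, -1} \<and> (\<forall>i>0. x i = 0)" for x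
    by (auto simp: nsphere power2_eq_1_iff)
  define e where "e c = (\<lambda>i :: nat. if i = 0 then c else 0 :: real)" for c
  have e: "e 1 \<in> topspace (nsphere 0)" "e (-1) \<in> topspace (nsphere 0)" by (auto simp: top e_def)
  have sph: "topspace (nsphere 0) = {e 1, e (-1)}"
  proof -
    have "x = e (x 0)" if "x \<in> topspace (nsphere 0)" for x
      using that unfolding top by (intro ext) (simp add: e_def)
    moreover have "x 0 \<in> {1, -1}" if "x \<in> topspace (nsphere 0)" for x
      using that unfolding top by simp
    ultimately have "topspace (nsphere 0) \<subseteq> {e 1, e (-1)}"
      by (intro subsetI) (metis insertE insertI1 insertI2 singletonD)
    then show ?thesis by (rule subset_antisym) (simp add: e)
  qed
  have ne: "e 1 \<noteq> e (-1)" by (auto simp: e_def fun_eq_iff intro!: exI[of _ 0])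
  have "\<not> path_component_of (nsphere 0) (e 1) (e (-1))"
  proof
    assume "path_component_of (nsphere 0) (e 1) (e (-1))"
    then obtain T where T: "path_connectedin (nsphere 0) T" "e 1 \<in> T" "e (-1) \<in> T"
      by (meson path_component_of)
    have "connectedin euclideanreal ((\<lambda>x. x 0) ` T)"
      using connectedin_continuous_map_image[OF continuous_map_nsphere_projection path_connectedin_imp_connectedin[OF T(1)]] .
    then have "is_interval ((\<lambda>x. x 0) ` T)" by (simp add: is_interval_connected_1)
    moreover have "1 \<in> (\<lambda>x. x 0) ` T" "-1 \<in> (\<lambda>x. x 0) ` T"
      using imageI[OF T(2), of "\<lambda>x. x 0"] imageI[OF T(3), of "\<lambda>x. x 0"] by (simp_all add: e_def)
    ultimately have "0 \<in> (\<lambda>x. x 0) ` T"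
      unfolding is_interval_1 by (meson zero_le_one neg_le_0_iff_le)
    then show False using path_connectedin_subset_topspace[OF T(1)] top by force
  qed
  then have "path_component_of_set (nsphere 0) (e 1) \<noteq> path_component_of_set (nsphere 0) (e (-1))"
    using path_component_of_eq[of "nsphere 0" "e 1" "e (-1)"] e by auto
  then show ?thesis
    by (simp add: path_components_of_def sph)
qed

text \<open>Degree zero is the only degree in which reduced and unreduced homology differ. The reduced group
  is the kernel of the map to the homology of a point; it is trivial here, and the map is onto because
  the point is a retract.\<close>

lemma homology_0_nsphere_Suc: "homology_group 0 (nsphere (Suc k)) \<cong> integer_group"
proof -
  let ?X = "nsphere (Suc k)" and ?p = "discrete_topology {()}"
  let ?h = "hom_induced 0 ?X {} ?p {} (\<lambda>x. ())"
  interpret h: group_hom "homology_group 0 ?X" "homology_group 0 ?p" ?h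
    by (simp add: group_hom_def group_hom_axioms_def hom_induced_empty_hom)
  obtain a where a: "a \<in> topspace ?X" using in_topspace_nsphere by blast
  have "retraction_map ?X ?p (\<lambda>x. ())"
    unfolding retraction_map_def retraction_maps_def using a by (intro exI[of _ "\<lambda>u. a"]) simp
  then have surj: "carrier (homology_group 0 ?p) = ?h ` carrier (homology_group 0 ?X)"
    by (rule surj_hom_induced_retraction_map)
  have "trivial_group (reduced_homology_group 0 ?X)"
    by (simp add: trivial_reduced_homology_group_nsphere)
  then have "kernel (homology_group 0 ?X) (homology_group 0 ?p) ?h = {\<one>\<^bsub>homology_group 0 ?X\<^esub>}"
    unfolding trivial_group_def carrier_reduced_homology_group one_reduced_homology_group by simp
  then have "?h \<in> iso (homology_group 0 ?X) (homology_group 0 ?p)"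
    unfolding h.iso_iff using surj by (auto simp: kernel_def)
  then show ?thesis
    using iso_trans[OF is_isoI homology_coefficients[of ?p "()"]] by simp
qed

text \<open>For \<open>k = 0\<close> and \<open>i = 0\<close> both summands contribute, one for each of the two points.\<close>

theorem group_rank_homology_nsphere:
  "group_rank (homology_group (int i) (nsphere k)) = enat ((if i = 0 then 1 else 0) + (if i = k then 1 else 0))"
proof (cases "i = 0")
  case True
  show ?thesis
  proof (cases k)
    case 0
    have "finite (path_components_of (nsphere 0))"
      using path_components_nsphere_0 by (intro card_ge_0_finite) simp
    from group_rank_free_Abelian_group[OF this]
    have "group_rank (homology_group 0 (nsphere 0)) = enat 2"
      using group_rank_iso[OF abelian_homology_group abelian_free_Abelian_group zeroth_homology_group[of "nsphere 0"]]
      by (simp add: path_components_nsphere_0)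
    then show ?thesis using True 0 by (simp add: numeral_2_eq_2)
  next
    case (Suc m)
    then show ?thesis
      using True group_rank_integer[OF abelian_homology_group homology_0_nsphere_Suc]
      by (simp add: one_enat_def)
  qed
next
  case False
  then have red: "homology_group (int i) (nsphere k) = reduced_homology_group (int i) (nsphere k)"
    by (simp add: un_reduced_homology_group)
  show ?thesis
  proof (cases "i = k")
    case True
    then have "homology_group (int i) (nsphere k) \<cong> integer_group"
      using red reduced_homology_group_nsphere(1) by simp
    then show ?thesis
      using True False group_rank_integer[OF abelian_homology_group] by (simp add: one_enat_def)
  next
    case ik: False
    then have "trivial_group (homology_group (int i) (nsphere k))"
      using red reduced_homology_group_nsphere(2) by simp
    then show ?thesis
      using ik False group_rank_trivial[OF abelian_homology_group] by (simp add: zero_enat_def)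
  qed
qed

lemma finite_homology_ranks_nsphere: "finite_homology_ranks (nsphere k)"
  by (simp add: finite_homology_ranks_def group_rank_homology_nsphere)

lemma poincare_nsphere: "poincare (nsphere k) = 1 + fps_X ^ k"
  by (rule fps_ext) (auto simp: poincare_def group_rank_homology_nsphere fps_X_power_nth)

lemma finite_homology_ranks_point: "finite_homology_ranks (discrete_topology {a})"
  by (simp add: finite_homology_ranks_def group_rank_homology_point zero_enat_def one_enat_def)

lemma poincare_point: "poincare (discrete_topology {a}) = 1"
  by (rule fps_ext) (simp add: poincare_def group_rank_homology_point one_enat_def zero_enat_def)

section \<open>Locally finite chains and finite truncations\<close>

text \<open>Restricted to the simplices that meet \<open>A\<close>, a chain is a representative of its class in the quotient
  \<open>C(X) / C(X - A)\<close>. Hence \<open>agree_on p A\<close> is equality in this quotient, stated for coefficient functions so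
  that it also compares a locally finite chain with a finite one.\<close>

definition agree_on :: "nat \<Rightarrow> 'a set \<Rightarrow> (((nat \<Rightarrow> real) \<Rightarrow> 'a) \<Rightarrow> int) \<Rightarrow> (((nat \<Rightarrow> real) \<Rightarrow> 'a) \<Rightarrow> int) \<Rightarrow> bool" where
  "agree_on p A c d \<longleftrightarrow> (\<forall>f. f ` standard_simplex p \<inter> A \<noteq> {} \<longrightarrow> c f = d f)"

lemma agree_onD: "agree_on p A c d \<Longrightarrow> f ` standard_simplex p \<inter> A \<noteq> {} \<Longrightarrow> c f = d f"
  unfolding agree_on_def by blast

lemma agree_on_refl [simp]: "agree_on p A c c"
  and agree_on_sym: "agree_on p A c d \<Longrightarrow> agree_on p A d c"
  and agree_on_trans: "agree_on p A c d \<Longrightarrow> agree_on p A d e \<Longrightarrow> agree_on p A c e"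
  and agree_on_subset: "agree_on p A c d \<Longrightarrow> B \<subseteq> A \<Longrightarrow> agree_on p B c d"
  unfolding agree_on_def by (simp_all, blast)

lemma simplex_face_image_subset:
  assumes "g \<in> Poly_Mapping.keys (chain_boundary p (frag_of f))"
  shows "g ` standard_simplex (p - Suc 0) \<subseteq> f ` standard_simplex p"
proof -
  have "p \<noteq> 0" using assms by (cases "p = 0") (auto simp: chain_boundary_def)
  have "Poly_Mapping.keys (\<Sum>k\<le>p. frag_cmul ((-1) ^ k) (frag_of (singular_face p k f)))
      \<subseteq> (\<Union>k\<in>{..p}. {singular_face p k f})"
    by (rule order_trans[OF keys_sum]) auto
  then obtain k where "k \<le> p" and g: "g = singular_face p k f"
    using assms \<open>p \<noteq> 0\<close> by (auto simp: chain_boundary_of)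
  then show ?thesis
    using \<open>p \<noteq> 0\<close> by (auto simp: singular_face_def intro!: imageI simplical_face_in_standard_simplex)
qed

lemma simplex_face_singular:
  assumes "g \<in> Poly_Mapping.keys (chain_boundary p (frag_of f))" "singular_simplex p X f"
  shows "singular_simplex (p - Suc 0) X g"
  using singular_chain_boundary[of p X "frag_of f"] assms
  by (auto simp: singular_chain_of singular_chain_def)

text \<open>If a face meets \<open>A\<close>, then so does every simplex of which it is a face. The coefficient of the boundary
  at such a face is therefore determined by the coefficients of simplices that meet \<open>A\<close>.\<close>

lemma lf_boundary_local:
  assumes "agree_on p A c d"
  shows "agree_on (p - Suc 0) A (lf_boundary p c) (lf_boundary p d)"
  unfolding agree_on_def
proof (intro allI impI)
  fix g :: "(nat \<Rightarrow> real) \<Rightarrow> 'a"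
  assume "g ` standard_simplex (p - Suc 0) \<inter> A \<noteq> {}"
  then have eq: "c f = d f" if "g \<in> Poly_Mapping.keys (chain_boundary p (frag_of f))" for f
    using simplex_face_image_subset[OF that] agree_onD[OF assms, of f] by blast
  then have "{f. c f \<noteq> 0 \<and> g \<in> Poly_Mapping.keys (chain_boundary p (frag_of f))}
           = {f. d f \<noteq> 0 \<and> g \<in> Poly_Mapping.keys (chain_boundary p (frag_of f))}"
    by auto
  then show "lf_boundary p c g = lf_boundary p d g"
    unfolding lf_boundary_def using eq by (auto intro: sum.cong)
qed

lemma lf_boundary_nonzero:
  assumes "lf_boundary p c g \<noteq> 0" and "\<And>f. c f \<noteq> 0 \<Longrightarrow> singular_simplex p X f"
  shows "singular_simplex (p - Suc 0) X g"
proof -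
  from assms(1) obtain f where "c f \<noteq> 0" "g \<in> Poly_Mapping.keys (chain_boundary p (frag_of f))"
    unfolding lf_boundary_def by (metis (mono_tags, lifting) mem_Collect_eq sum.neutral)
  then show ?thesis using assms(2) simplex_face_singular by blast
qed

lemma singular_simplex_image_topspace:
  "singular_simplex p X f \<Longrightarrow> f ` standard_simplex p \<subseteq> topspace X"
  by (auto simp: singular_simplex_def continuous_map_def)

text \<open>Here and in \<open>relcycle_avoiding_iff\<close> and \<open>relboundary_avoiding_iff\<close>, notions relative to the complement
  of \<open>A\<close> become conditions on coefficients, the form in which they pass to limits of chains.\<close>

lemma singular_chain_avoiding_iff:
  "singular_chain p (subtopology X (topspace X - A)) c \<longleftrightarrow>
     singular_chain p X c \<and> agree_on p A (Poly_Mapping.lookup c) (\<lambda>f. 0)"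
proof -
  have "(\<forall>f\<in>Poly_Mapping.keys c. f ` standard_simplex p \<subseteq> topspace X - A)
      \<longleftrightarrow> agree_on p A (Poly_Mapping.lookup c) (\<lambda>f. 0)" if "singular_chain p X c"
  proof -
    have "f ` standard_simplex p \<subseteq> topspace X" if "f \<in> Poly_Mapping.keys c" for f
      using that \<open>singular_chain p X c\<close> singular_simplex_image_topspace
      unfolding singular_chain_def by blast
    then have "(\<forall>f\<in>Poly_Mapping.keys c. f ` standard_simplex p \<subseteq> topspace X - A)
        \<longleftrightarrow> (\<forall>f\<in>Poly_Mapping.keys c. f ` standard_simplex p \<inter> A = {})"
      by (intro ball_cong) (simp_all add: Diff_eq disjoint_eq_subset_Compl)
    also have "\<dots> \<longleftrightarrow> agree_on p A (Poly_Mapping.lookup c) (\<lambda>f. 0)"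
      unfolding agree_on_def Ball_def in_keys_iff by (intro all_cong1) argo
    finally show ?thesis .
  qed
  then show ?thesis
    by (auto simp: singular_chain_subtopology)
qed

lemma agree_on_diff_0:
  "agree_on p A (Poly_Mapping.lookup (c - d)) (\<lambda>f. 0) \<longleftrightarrow> agree_on p A (Poly_Mapping.lookup c) (Poly_Mapping.lookup d)"
  by (simp add: agree_on_def lookup_minus)

lemma relcycle_avoiding_iff:
  "singular_relcycle p X (topspace X - A) c \<longleftrightarrow>
     singular_chain p X c \<and> agree_on (p - Suc 0) A (Poly_Mapping.lookup (chain_boundary p c)) (\<lambda>f. 0)"
  using singular_chain_boundary[of p X c] by (auto simp: singular_relcycle singular_chain_avoiding_iff)

lemma relboundary_avoiding_iff:
  "singular_relboundary p X (topspace X - A) c \<longleftrightarrow> singular_chain p X c \<and>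
     (\<exists>d. singular_chain (Suc p) X d \<and>
        agree_on p A (Poly_Mapping.lookup (chain_boundary (Suc p) d)) (Poly_Mapping.lookup c))"
proof
  assume L: "singular_relboundary p X (topspace X - A) c"
  then show "singular_chain p X c \<and>
     (\<exists>d. singular_chain (Suc p) X d \<and>
        agree_on p A (Poly_Mapping.lookup (chain_boundary (Suc p) d)) (Poly_Mapping.lookup c))"
    using singular_relboundary_imp_chain[OF L]
    by (auto simp: singular_relboundary_def mod_subset_def singular_chain_avoiding_iff agree_on_diff_0)
next
  assume R: "singular_chain p X c \<and>
     (\<exists>d. singular_chain (Suc p) X d \<and>
        agree_on p A (Poly_Mapping.lookup (chain_boundary (Suc p) d)) (Poly_Mapping.lookup c))"
  then obtain d where d: "singular_chain (Suc p) X d"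
      "agree_on p A (Poly_Mapping.lookup (chain_boundary (Suc p) d)) (Poly_Mapping.lookup c)" by blast
  have "singular_chain p X (chain_boundary (Suc p) d - c)"
    using singular_chain_diff[OF singular_chain_boundary_alt[OF d(1)]] R by blast
  then show "singular_relboundary p X (topspace X - A) c"
    using d unfolding singular_relboundary_def mod_subset_def
    by (intro exI[of _ d]) (simp add: singular_chain_avoiding_iff agree_on_diff_0)
qed

lemma lf_chain_locally_finite:
  assumes "c \<in> lf_chain_set p X" "x \<in> topspace X"
  shows "\<exists>U. openin X U \<and> x \<in> U \<and> finite {f. c f \<noteq> 0 \<and> f ` standard_simplex p \<inter> U \<noteq> {}}"
  using assms by (simp add: lf_chain_set_def)

lemma lf_chain_singular: "c \<in> lf_chain_set p X \<Longrightarrow> c f \<noteq> 0 \<Longrightarrow> singular_simplex p X f"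
  by (simp add: lf_chain_set_def)

lemma lf_chain_setI:
  assumes "\<And>f. c f \<noteq> 0 \<Longrightarrow> singular_simplex p X f"
    and "\<And>x. x \<in> topspace X \<Longrightarrow>
      \<exists>U. openin X U \<and> x \<in> U \<and> finite {f. c f \<noteq> 0 \<and> f ` standard_simplex p \<inter> U \<noteq> {}}"
  shows "c \<in> lf_chain_set p X"
  using assms by (simp add: lf_chain_set_def)

text \<open>Local finiteness gives each point a neighbourhood that meets finitely many simplices of the chain, and
  finitely many of these neighbourhoods cover \<open>A\<close>.\<close>

lemma lf_chain_finite_on_compact:
  assumes c: "c \<in> lf_chain_set p X" and A: "compactin X A"
  shows "finite {f. c f \<noteq> 0 \<and> f ` standard_simplex p \<inter> A \<noteq> {}}"
proof -
  \<comment> \<open>Naming the condition keeps its set comprehension opaque in the choice of neighbourhoods below.\<close>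
  define fin where "fin V \<longleftrightarrow> finite {f. c f \<noteq> 0 \<and> f ` standard_simplex p \<inter> V \<noteq> {}}" for V
  have "\<forall>x\<in>A. \<exists>U. openin X U \<and> x \<in> U \<and> fin U"
    using lf_chain_locally_finite[OF c] compactin_subset_topspace[OF A] unfolding fin_def by (simp add: subsetD)
  then obtain U where U: "\<And>x. x \<in> A \<Longrightarrow> openin X (U x) \<and> x \<in> U x \<and> fin (U x)"
    by metis
  have "(\<forall>V\<in>U ` A. openin X V) \<and> A \<subseteq> \<Union>(U ` A)" using U by auto
  then have "\<exists>\<F>. finite \<F> \<and> \<F> \<subseteq> U ` A \<and> A \<subseteq> \<Union>\<F>"
    using A unfolding compactin_def by presburger
  then obtain \<F> where \<F>: "finite \<F>" "\<F> \<subseteq> U ` A" "A \<subseteq> \<Union>\<F>" by (elim exE conjE)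
  from finite_subset_image[OF \<F>(1,2)]
  obtain B where B: "B \<subseteq> A" "finite B" "\<F> = U ` B" by (elim exE conjE)
  have "{f. c f \<noteq> 0 \<and> f ` standard_simplex p \<inter> A \<noteq> {}}
      \<subseteq> (\<Union>x\<in>B. {f. c f \<noteq> 0 \<and> f ` standard_simplex p \<inter> U x \<noteq> {}})"
    using B(3) \<F>(3) by auto
  moreover have "finite \<dots>" using B U by (simp add: fin_def subsetD)
  ultimately show ?thesis by (rule finite_subset)
qed

text \<open>This is the image of a locally finite chain in \<open>C(X) / C(X - A)\<close>, given by its representative
  supported on simplices that meet \<open>A\<close>. The abstraction function gives the intended finitely supported mapping
  only if finitely many coefficients remain, which holds for compact \<open>A\<close>.\<close>

definition truncate_chain :: "nat \<Rightarrow> 'a set \<Rightarrow> (((nat \<Rightarrow> real) \<Rightarrow> 'a) \<Rightarrow> int) \<Rightarrow> 'a chain" where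
  "truncate_chain p A c = Abs_poly_mapping (\<lambda>f. if f ` standard_simplex p \<inter> A \<noteq> {} then c f else 0)"

lemma lookup_truncate_chain:
  assumes "c \<in> lf_chain_set p X" "compactin X A"
  shows "Poly_Mapping.lookup (truncate_chain p A c) =
           (\<lambda>f. if f ` standard_simplex p \<inter> A \<noteq> {} then c f else 0)"
  unfolding truncate_chain_def
  by (rule lookup_Abs_poly_mapping)
     (rule finite_subset[OF _ lf_chain_finite_on_compact[OF assms]], rule Collect_mono, simp)

lemma truncate_chain:
  assumes "c \<in> lf_chain_set p X" "compactin X A"
  shows singular_chain_truncate: "singular_chain p X (truncate_chain p A c)"
    and agree_on_truncate: "agree_on p A (Poly_Mapping.lookup (truncate_chain p A c)) c"
  using lf_chain_singular[OF assms(1)]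
  by (simp_all add: singular_chain_def subset_iff in_keys_iff lookup_truncate_chain[OF assms] agree_on_def)

lemma agree_on_boundary_truncate:
  assumes "c \<in> lf_chain_set p X" "compactin X A"
  shows "agree_on (p - Suc 0) A (Poly_Mapping.lookup (chain_boundary p (truncate_chain p A c))) (lf_boundary p c)"
  using lf_boundary_local[OF agree_on_truncate[OF assms]] by (simp add: lf_boundary_finite_chain)

lemma lf_chain_set_add:
  assumes c: "c \<in> lf_chain_set p X" and d: "d \<in> lf_chain_set p X"
  shows "(\<lambda>f. c f + d f) \<in> lf_chain_set p X"
proof -
  have "\<exists>U. openin X U \<and> x \<in> U \<and> finite {f. c f + d f \<noteq> 0 \<and> f ` standard_simplex p \<inter> U \<noteq> {}}"
    if x: "x \<in> topspace X" for x
  proof -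
    obtain U where U: "openin X U" "x \<in> U" "finite {f. c f \<noteq> 0 \<and> f ` standard_simplex p \<inter> U \<noteq> {}}"
      using lf_chain_locally_finite[OF c x] by (elim exE conjE)
    obtain V where V: "openin X V" "x \<in> V" "finite {f. d f \<noteq> 0 \<and> f ` standard_simplex p \<inter> V \<noteq> {}}"
      using lf_chain_locally_finite[OF d x] by (elim exE conjE)
    have "{f. c f + d f \<noteq> 0 \<and> f ` standard_simplex p \<inter> (U \<inter> V) \<noteq> {}}
        \<subseteq> {f. c f \<noteq> 0 \<and> f ` standard_simplex p \<inter> U \<noteq> {}} \<union> {f. d f \<noteq> 0 \<and> f ` standard_simplex p \<inter> V \<noteq> {}}"
      by auto
    then show ?thesis
      using U V by (intro exI[of _ "U \<inter> V"]) (auto intro: finite_subset)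
  qed
  moreover have "singular_simplex p X f" if "c f + d f \<noteq> 0" for f
    using that lf_chain_singular[OF c] lf_chain_singular[OF d] by (cases "c f = 0") auto
  ultimately show ?thesis by (intro lf_chain_setI)
qed

lemma lf_chain_set_0: "(\<lambda>f. 0) \<in> lf_chain_set p X"
  unfolding lf_chain_set_def by auto

lemma lf_chain_set_uminus: "c \<in> lf_chain_set p X \<Longrightarrow> (\<lambda>f. - c f) \<in> lf_chain_set p X"
  unfolding lf_chain_set_def by simp

lemma finite_agreeing_support:
  assumes "agree_on p A c (Poly_Mapping.lookup z)" "U \<subseteq> A"
  shows "finite {f. c f \<noteq> 0 \<and> f ` standard_simplex p \<inter> U \<noteq> {}}"
proof (rule finite_subset[OF _ finite_keys[of z]], rule subsetI)
  fix f assume "f \<in> {f. c f \<noteq> 0 \<and> f ` standard_simplex p \<inter> U \<noteq> {}}"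
  then have "c f \<noteq> 0" "f ` standard_simplex p \<inter> A \<noteq> {}"
    using assms(2) by (simp_all add: disjoint_iff) (meson subsetD)
  then show "f \<in> Poly_Mapping.keys z"
    using agree_onD[OF assms(1)] by (simp add: in_keys_iff)
qed

section \<open>Locally finite chains as an inverse limit\<close>

text \<open>Exhaustion by interiors, not merely by the sets, is what makes a chain that is finite on every \<open>K k\<close>
  locally finite.\<close>

locale compact_exhaustion =
  fixes X :: "'a topology" and K :: "nat \<Rightarrow> 'a set"
  assumes compact: "compactin X (K k)"
    and increasing: "K k \<subseteq> K (Suc k)"
    and exhausting: "x \<in> topspace X \<Longrightarrow> \<exists>k. x \<in> X interior_of K k"
begin

lemma mono: "i \<le> j \<Longrightarrow> K i \<subseteq> K j"
  by (rule lift_Suc_mono_le[of K]) (simp_all add: increasing)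

lemma simplex_meets:
  assumes "singular_simplex p X f"
  shows "\<exists>k. f ` standard_simplex p \<inter> K k \<noteq> {}"
proof -
  obtain v where v: "v \<in> standard_simplex p" using nonempty_standard_simplex by blast
  then have fv: "f v \<in> topspace X" using singular_simplex_image_topspace[OF assms] by blast
  obtain k where "f v \<in> X interior_of K k" using exhausting[OF fv] by (elim exE)
  then have "f v \<in> f ` standard_simplex p \<inter> K k" using v interior_of_subset[of X "K k"] by auto
  then show ?thesis by (intro exI[of _ k]) auto
qed

text \<open>The map from locally finite chains to the inverse limit is injective, because every simplex meets
  some \<open>K k\<close>.\<close>

lemma lf_eqI:
  assumes "\<And>f. c f \<noteq> 0 \<Longrightarrow> singular_simplex p X f" "\<And>f. d f \<noteq> 0 \<Longrightarrow> singular_simplex p X f"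
    and "\<And>k. agree_on p (K k) c d"
  shows "c = d"
proof
  fix f show "c f = d f"
  proof (cases "singular_simplex p X f")
    case True then show ?thesis using simplex_meets assms(3) agree_onD by blast
  next
    case False then show ?thesis using assms(1,2) by metis
  qed
qed

text \<open>The map from locally finite chains to the inverse limit is surjective: on a given simplex a compatible
  sequence of finite chains is eventually constant.\<close>

lemma lf_chain_limit:
  assumes z: "\<And>k. singular_chain p X (z k)"
    and compat: "\<And>k. agree_on p (K k) (Poly_Mapping.lookup (z (Suc k))) (Poly_Mapping.lookup (z k))"
  shows "\<exists>c\<in>lf_chain_set p X. \<forall>k. agree_on p (K k) c (Poly_Mapping.lookup (z k))"
proof -
  have compat': "agree_on p (K i) (Poly_Mapping.lookup (z j)) (Poly_Mapping.lookup (z i))" if "i \<le> j" for i j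
    using that
  proof (induction j rule: dec_induct)
    case (step j)
    then show ?case using agree_on_subset[OF compat mono] agree_on_trans by blast
  qed simp
  \<comment> \<open>From index \<open>N f\<close> on, all chains of the sequence have the same coefficient at \<open>f\<close>. For a function
    \<open>f\<close> that is not a simplex \<open>N f\<close> is a default value, and all coefficients at \<open>f\<close> vanish.\<close>
  define N where "N f = (LEAST k. f ` standard_simplex p \<inter> K k \<noteq> {})" for f :: "(nat \<Rightarrow> real) \<Rightarrow> 'a"
  define c where "c f = Poly_Mapping.lookup (z (N f)) f" for f
  have agree: "agree_on p (K k) c (Poly_Mapping.lookup (z k))" for k
    unfolding agree_on_def
  proof (intro allI impI)
    fix f :: "(nat \<Rightarrow> real) \<Rightarrow> 'a" assume f: "f ` standard_simplex p \<inter> K k \<noteq> {}"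
    have "N f \<le> k" "f ` standard_simplex p \<inter> K (N f) \<noteq> {}"
      unfolding N_def by (rule Least_le[where P="\<lambda>k. f ` standard_simplex p \<inter> K k \<noteq> {}", OF f],
        rule LeastI[where P="\<lambda>k. f ` standard_simplex p \<inter> K k \<noteq> {}", OF f])
    then show "c f = Poly_Mapping.lookup (z k) f"
      using agree_onD[OF compat'] unfolding c_def by metis
  qed
  have "singular_simplex p X f" if "c f \<noteq> 0" for f
    using that z[of "N f"] unfolding c_def singular_chain_def by (auto simp: in_keys_iff)
  moreover have "\<exists>U. openin X U \<and> x \<in> U \<and> finite {f. c f \<noteq> 0 \<and> f ` standard_simplex p \<inter> U \<noteq> {}}"
    if x: "x \<in> topspace X" for x
  proof -
    obtain k where k: "x \<in> X interior_of K k" using exhausting[OF x] by (elim exE)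
    have "finite {f. c f \<noteq> 0 \<and> f ` standard_simplex p \<inter> X interior_of K k \<noteq> {}}"
      by (rule finite_agreeing_support[OF agree interior_of_subset])
    then show ?thesis
      using k by (intro exI[of _ "X interior_of K k"]) simp
  qed
  ultimately have "c \<in> lf_chain_set p X" by (intro lf_chain_setI)
  then show ?thesis using agree by blast
qed

lemma lf_boundary_singular:
  "c \<in> lf_chain_set p X \<Longrightarrow> lf_boundary p c g \<noteq> 0 \<Longrightarrow> singular_simplex (p - Suc 0) X g"
  using lf_boundary_nonzero lf_chain_singular by blast

lemma lf_boundary_in_lf_chain_set:
  assumes c: "c \<in> lf_chain_set p X"
  shows "lf_boundary p c \<in> lf_chain_set (p - Suc 0) X"
proof -
  have "\<exists>U. openin X U \<and> x \<in> U \<and> finite {g. lf_boundary p c g \<noteq> 0 \<and> g ` standard_simplex (p - Suc 0) \<inter> U \<noteq> {}}"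
    if x: "x \<in> topspace X" for x
  proof -
    obtain k where k: "x \<in> X interior_of K k" using exhausting[OF x] by (elim exE)
    have "finite {g. lf_boundary p c g \<noteq> 0 \<and> g ` standard_simplex (p - Suc 0) \<inter> X interior_of K k \<noteq> {}}"
      by (rule finite_agreeing_support[OF agree_on_sym[OF agree_on_boundary_truncate[OF c compact]] interior_of_subset])
    then show ?thesis
      using k by (intro exI[of _ "X interior_of K k"]) simp
  qed
  then show ?thesis
    using lf_boundary_singular[OF c] by (intro lf_chain_setI)
qed

text \<open>The boundary is a sum over an index set that depends on the chain, so additivity is not immediate. It
  is inherited from finite chains by truncation, and so is \<open>lf_boundary_boundary\<close>.\<close>

lemma lf_boundary_add:
  assumes c: "c \<in> lf_chain_set p X" and d: "d \<in> lf_chain_set p X"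
  shows "lf_boundary p (\<lambda>f. c f + d f) = (\<lambda>g. lf_boundary p c g + lf_boundary p d g)"
proof (rule lf_eqI[where p = "p - Suc 0"])
  show "singular_simplex (p - Suc 0) X g" if "lf_boundary p (\<lambda>f. c f + d f) g \<noteq> 0" for g
    using lf_boundary_singular[OF lf_chain_set_add[OF c d] that] .
  show "singular_simplex (p - Suc 0) X g" if "lf_boundary p c g + lf_boundary p d g \<noteq> 0" for g
    using lf_boundary_singular[OF c, of g] lf_boundary_singular[OF d, of g] that
    by (cases "lf_boundary p c g = 0") auto
  fix k
  have "agree_on p (K k) (\<lambda>f. c f + d f) (Poly_Mapping.lookup (truncate_chain p (K k) c + truncate_chain p (K k) d))"
    using agree_on_truncate[OF c compact] agree_on_truncate[OF d compact] by (simp add: agree_on_def lookup_add)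
  from lf_boundary_local[OF this]
  show "agree_on (p - Suc 0) (K k) (lf_boundary p (\<lambda>f. c f + d f)) (\<lambda>g. lf_boundary p c g + lf_boundary p d g)"
    using agree_on_boundary_truncate[OF c compact, of k] agree_on_boundary_truncate[OF d compact, of k]
    by (simp add: agree_on_def lookup_add lf_boundary_finite_chain chain_boundary_add)
qed

lemma lf_boundary_uminus:
  "lf_boundary p (\<lambda>f. - c f) = (\<lambda>g. - lf_boundary p c g)"
  by (simp add: lf_boundary_def sum_negf)

lemma lf_boundary_boundary:
  assumes c: "c \<in> lf_chain_set p X"
  shows "lf_boundary (p - Suc 0) (lf_boundary p c) = (\<lambda>g. 0)"
proof (rule lf_eqI[where p = "p - Suc 0 - Suc 0"])
  show "singular_simplex (p - Suc 0 - Suc 0) X g" if "lf_boundary (p - Suc 0) (lf_boundary p c) g \<noteq> 0" for g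
    using lf_boundary_singular[OF lf_boundary_in_lf_chain_set[OF c] that] .
  fix k
  have "chain_boundary (p - Suc 0) (chain_boundary p (truncate_chain p (K k) c)) = 0"
    using chain_boundary_boundary singular_chain_truncate[OF c compact] by blast
  then show "agree_on (p - Suc 0 - Suc 0) (K k) (lf_boundary (p - Suc 0) (lf_boundary p c)) (\<lambda>g. 0)"
    using lf_boundary_local[OF agree_on_boundary_truncate[OF c compact], of k]
    by (simp add: agree_on_def lf_boundary_finite_chain)
qed simp_all

lemma lf_cycle_carrier:
  "c \<in> carrier (lf_cycle_group p X) \<longleftrightarrow> c \<in> lf_chain_set p X \<and> lf_boundary p c = (\<lambda>g. 0)"
  by (simp add: lf_cycle_group_def)

lemma lf_cycle_group_simps [simp]:
  "monoid.mult (lf_cycle_group p X) c d = (\<lambda>f. c f + d f)" "one (lf_cycle_group p X) = (\<lambda>f. 0)"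
  by (simp_all add: lf_cycle_group_def)

lemma group_lf_cycle_group: "group (lf_cycle_group p X)"
proof (rule groupI)
  show "\<exists>d\<in>carrier (lf_cycle_group p X). d \<otimes>\<^bsub>lf_cycle_group p X\<^esub> c = \<one>\<^bsub>lf_cycle_group p X\<^esub>"
    if "c \<in> carrier (lf_cycle_group p X)" for c
    using that by (intro bexI[of _ "\<lambda>f. - c f"]) (auto simp: lf_cycle_carrier lf_chain_set_uminus lf_boundary_uminus)
qed (auto simp: lf_cycle_carrier lf_chain_set_add lf_boundary_add lf_chain_set_0 add.assoc,
     simp add: lf_boundary_def)

end

section \<open>Borel-Moore homology as relative homology\<close>

text \<open>Stability makes the tower of relative homology groups constant, so that its inverse limit is the group
  at level zero.\<close>

locale homology_stable_exhaustion = compact_exhaustion +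
  assumes stable: "bij_betw (hom_induced (int p) X (topspace X - K (Suc k)) X (topspace X - K k) id)
      (carrier (relative_homology_group (int p) X (topspace X - K (Suc k))))
      (carrier (relative_homology_group (int p) X (topspace X - K k)))"
begin

abbreviation S where "S k \<equiv> topspace X - K k"

lemma hom_induced_restriction:
  assumes "singular_relcycle p X (S (Suc k)) z"
  shows "hom_induced (int p) X (S (Suc k)) X (S k) id (homologous_rel_set p X (S (Suc k)) z)
       = homologous_rel_set p X (S k) z"
proof -
  have "chain_map p id z = z"
    using assms singular_relcycle chain_map_id_gen by (metis id_apply)
  then show ?thesis
    using increasing[of k] assms by (subst hom_induced_chain_map_gen) auto
qed

text \<open>Surjectivity and injectivity of the stability maps in terms of chains: this lemma and the next one are
  the two lifting properties used in the limit arguments.\<close>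

lemma relcycle_lift:
  assumes "singular_relcycle p X (S k) z"
  shows "\<exists>w. singular_relcycle p X (S (Suc k)) w \<and> homologous_rel p X (S k) w z"
proof -
  have "homologous_rel_set p X (S k) z \<in> carrier (relative_homology_group (int p) X (S k))"
    using assms by (simp add: carrier_relative_homology_group)
  then have "homologous_rel_set p X (S k) z \<in> hom_induced (int p) X (S (Suc k)) X (S k) id `
      homologous_rel_set p X (S (Suc k)) ` singular_relcycle_set p X (S (Suc k))"
    using bij_betw_imp_surj_on[OF stable[of p k]] by (simp add: carrier_relative_homology_group)
  then obtain w where "singular_relcycle p X (S (Suc k)) w"
    "homologous_rel_set p X (S k) z = homologous_rel_set p X (S k) w"
    using hom_induced_restriction by (elim imageE) simp
  then show ?thesis by (intro exI[of _ w]) (simp add: homologous_rel_set_eq homologous_rel_sym)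
qed

lemma relboundary_lift:
  assumes "singular_relcycle p X (S (Suc k)) z" "singular_relboundary p X (S k) z"
  shows "singular_relboundary p X (S (Suc k)) z"
proof -
  have 0: "singular_relcycle p X (S (Suc k)) 0" by simp
  have "homologous_rel_set p X (S k) z = homologous_rel_set p X (S k) 0"
    by (rule iffD2[OF homologous_rel_set_eq]) (simp add: homologous_rel_def assms(2))
  then have "hom_induced (int p) X (S (Suc k)) X (S k) id (homologous_rel_set p X (S (Suc k)) z)
      = hom_induced (int p) X (S (Suc k)) X (S k) id (homologous_rel_set p X (S (Suc k)) 0)"
    by (simp only: hom_induced_restriction[OF 0] hom_induced_restriction[OF assms(1)])
  then have "homologous_rel_set p X (S (Suc k)) z = homologous_rel_set p X (S (Suc k)) 0"
    by (rule inj_onD[OF bij_betw_imp_inj_on[OF stable[of p k]]])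
       (use 0 assms(1) in \<open>auto simp only: carrier_relative_homology_group mem_Collect_eq intro: imageI\<close>)
  then have "homologous_rel p X (S (Suc k)) z 0" by (rule iffD1[OF homologous_rel_set_eq])
  then show ?thesis by (simp add: homologous_rel_def)
qed

text \<open>Surjectivity of truncation on homology. A relative cycle lifts along the tower up to homology; after
  correcting each lift by a boundary, consecutive lifts agree on \<open>K k\<close> and have a limit.\<close>

lemma lf_cycle_extends:
  assumes "singular_relcycle p X (S 0) z"
  shows "\<exists>c\<in>carrier (lf_cycle_group p X). singular_relboundary p X (S 0) (truncate_chain p (K 0) c - z)"
proof -
  have "\<exists>w. w 0 = z \<and> (\<forall>k. singular_relcycle p X (S k) (w k) \<and>
      agree_on p (K k) (Poly_Mapping.lookup (w (Suc k))) (Poly_Mapping.lookup (w k)))"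
  proof -
    have "\<exists>y. singular_relcycle p X (S (Suc k)) y \<and>
       agree_on p (K k) (Poly_Mapping.lookup y) (Poly_Mapping.lookup x)"
      if x: "singular_relcycle p X (S k) x" for x k
    proof -
      obtain w where w: "singular_relcycle p X (S (Suc k)) w" "homologous_rel p X (S k) w x"
        using relcycle_lift[OF x] by blast
      then obtain e where e: "singular_chain (Suc p) X e"
        "agree_on p (K k) (Poly_Mapping.lookup (chain_boundary (Suc p) e)) (Poly_Mapping.lookup (w - x))"
        by (auto simp: homologous_rel_def relboundary_avoiding_iff)
      \<comment> \<open>Subtracting the boundary of \<open>e\<close> makes the lift agree with \<open>x\<close> on \<open>K k\<close> without changing its own
        boundary.\<close>
      have "chain_boundary p (chain_boundary (Suc p) e) = 0"
        using chain_boundary_boundary[OF e(1)] by simp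
      then have "singular_relcycle p X (S (Suc k)) (w - chain_boundary (Suc p) e)"
        using w(1) singular_chain_boundary_alt[OF e(1)]
        by (simp add: relcycle_avoiding_iff chain_boundary_diff singular_chain_diff)
      moreover have "agree_on p (K k) (Poly_Mapping.lookup (w - chain_boundary (Suc p) e)) (Poly_Mapping.lookup x)"
        using e(2) by (simp add: agree_on_def lookup_minus)
      ultimately show ?thesis by blast
    qed
    then show ?thesis
      using dependent_nat_choice[of "\<lambda>k w. singular_relcycle p X (S k) w \<and> (k = 0 \<longrightarrow> w = z)"
       "\<lambda>k w w'. agree_on p (K k) (Poly_Mapping.lookup w') (Poly_Mapping.lookup w)"] assms
      by (metis nat.distinct(1))
  qed
  then obtain w where w: "w 0 = z" "\<And>k. singular_relcycle p X (S k) (w k)"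
      "\<And>k. agree_on p (K k) (Poly_Mapping.lookup (w (Suc k))) (Poly_Mapping.lookup (w k))"
    by blast
  obtain c where c: "c \<in> lf_chain_set p X" "\<And>k. agree_on p (K k) c (Poly_Mapping.lookup (w k))"
    using lf_chain_limit[of p w] w by (metis singular_relcycle)
  have "lf_boundary p c = (\<lambda>g. 0)"
  proof (rule lf_eqI[where p = "p - Suc 0"])
    show "agree_on (p - Suc 0) (K k) (lf_boundary p c) (\<lambda>g. 0)" for k
      using lf_boundary_local[OF c(2)[of k]] w(2)[of k] agree_on_trans
      by (auto simp: lf_boundary_finite_chain relcycle_avoiding_iff)
  qed (use lf_boundary_singular[OF c(1)] in auto)
  moreover have "singular_relboundary p X (S 0) (truncate_chain p (K 0) c - z)"
  proof (rule singular_chain_imp_relboundary)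
    show "singular_chain p (subtopology X (S 0)) (truncate_chain p (K 0) c - z)"
      using agree_on_trans[OF agree_on_truncate[OF c(1) compact] c(2)] w(1) assms
        singular_chain_truncate[OF c(1) compact]
      by (auto simp: singular_chain_avoiding_iff agree_on_diff_0 singular_relcycle singular_chain_diff)
  qed
  ultimately show ?thesis using c(1) lf_cycle_carrier by blast
qed

lemma truncate_relcycle:
  assumes "c \<in> carrier (lf_cycle_group p X)"
  shows "singular_relcycle p X (S k) (truncate_chain p (K k) c)"
  using assms agree_on_boundary_truncate[of c p X "K k"] singular_chain_truncate[of c p X "K k"] compact
  by (auto simp: relcycle_avoiding_iff lf_cycle_carrier)

text \<open>Injectivity of truncation on homology. The truncations of \<open>c\<close> bound at every level of the tower. The
  bounding chains at consecutive levels differ by a relative cycle of one degree higher; lifting that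
  cycle allows the next bounding chain to be corrected so that the two agree on \<open>K k\<close>.\<close>

lemma lf_cycle_bounds:
  assumes c: "c \<in> carrier (lf_cycle_group p X)"
    and c0: "singular_relboundary p X (S 0) (truncate_chain p (K 0) c)"
  shows "\<exists>e\<in>lf_chain_set (Suc p) X. lf_boundary (Suc p) e = c"
proof -
  let ?c = "\<lambda>k. truncate_chain p (K k) c"
  have cl: "c \<in> lf_chain_set p X" using c lf_cycle_carrier by blast
  have c_agree: "agree_on p (K k) (Poly_Mapping.lookup (?c k)) c" for k
    using agree_on_truncate[OF cl compact] .
  have diff: "singular_relboundary p X (S k) (?c (Suc k) - ?c k)" for k
  proof (rule singular_chain_imp_relboundary)
    have "agree_on p (K k) (Poly_Mapping.lookup (?c (Suc k))) (Poly_Mapping.lookup (?c k))"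
      using agree_on_subset[OF c_agree increasing] agree_on_sym[OF c_agree] by (rule agree_on_trans)
    then show "singular_chain p (subtopology X (S k)) (?c (Suc k) - ?c k)"
      using singular_chain_truncate[OF cl compact]
      by (simp add: singular_chain_avoiding_iff agree_on_diff_0 singular_chain_diff)
  qed
  have bd: "singular_relboundary p X (S k) (?c k)" for k
  proof (induction k)
    case (Suc k)
    have "singular_relboundary p X (S k) (?c (Suc k))"
      using singular_relboundary_add[OF diff Suc] by simp
    then show ?case using relboundary_lift truncate_relcycle[OF c] by blast
  qed (rule c0)
  define good where "good k e \<longleftrightarrow> singular_chain (Suc p) X e \<and>
      agree_on p (K k) (Poly_Mapping.lookup (chain_boundary (Suc p) e)) c" for k e
  have good: "\<exists>e. good k e" for k
    using bd[of k] c_agree agree_on_trans unfolding good_def relboundary_avoiding_iff by blast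
  have step: "\<exists>y. good (Suc k) y \<and> agree_on (Suc p) (K k) (Poly_Mapping.lookup y) (Poly_Mapping.lookup x)"
    if x: "good k x" for x k
  proof -
    obtain e where e: "good (Suc k) e" using good by blast
    have "singular_relcycle (Suc p) X (S k) (e - x)"
      using e x agree_on_subset[OF _ increasing[of k]] agree_on_trans agree_on_sym
      unfolding good_def relcycle_avoiding_iff
      by (simp add: chain_boundary_diff agree_on_diff_0 singular_chain_diff) blast
    then obtain w where w: "singular_relcycle (Suc p) X (S (Suc k)) w" "homologous_rel (Suc p) X (S k) w (e - x)"
      using relcycle_lift by blast
    then obtain h where h: "singular_chain (Suc (Suc p)) X h"
      "agree_on (Suc p) (K k) (Poly_Mapping.lookup (chain_boundary (Suc (Suc p)) h)) (Poly_Mapping.lookup (w - (e - x)))"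
      by (auto simp: homologous_rel_def relboundary_avoiding_iff)
    have bb: "chain_boundary (Suc p) (chain_boundary (Suc (Suc p)) h) = 0"
      using chain_boundary_boundary[OF h(1)] by simp
    \<comment> \<open>On \<open>K k\<close> the boundary of \<open>h\<close> equals \<open>w - (e - x)\<close>, so \<open>?y\<close> agrees with \<open>x\<close> there; subtracting the
      cycle \<open>w\<close> does not affect the relative boundary at level \<open>Suc k\<close>.\<close>
    let ?y = "e - w + chain_boundary (Suc (Suc p)) h"
    have "good (Suc k) ?y"
      using e w(1) h(1) bb unfolding good_def relcycle_avoiding_iff
      by (auto simp: chain_boundary_diff chain_boundary_add agree_on_def lookup_minus
          intro!: singular_chain_add singular_chain_diff singular_chain_boundary_alt)
    moreover have "agree_on (Suc p) (K k) (Poly_Mapping.lookup ?y) (Poly_Mapping.lookup x)"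
      using h(2) by (simp add: agree_on_def lookup_minus lookup_add)
    ultimately show ?thesis by blast
  qed
  obtain e where e: "\<And>k. good k (e k)"
      "\<And>k. agree_on (Suc p) (K k) (Poly_Mapping.lookup (e (Suc k))) (Poly_Mapping.lookup (e k))"
    using dependent_nat_choice[of good "\<lambda>k w w'. agree_on (Suc p) (K k) (Poly_Mapping.lookup w') (Poly_Mapping.lookup w)"]
      good step by metis
  obtain E where E: "E \<in> lf_chain_set (Suc p) X" "\<And>k. agree_on (Suc p) (K k) E (Poly_Mapping.lookup (e k))"
    using lf_chain_limit[of "Suc p" e] e unfolding good_def by blast
  have "lf_boundary (Suc p) E = c"
  proof (rule lf_eqI[where p = p])
    show "agree_on p (K k) (lf_boundary (Suc p) E) c" for k
      using lf_boundary_local[OF E(2)[of k]] e(1)[of k] agree_on_trans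
      by (auto simp: lf_boundary_finite_chain good_def)
  qed (use lf_boundary_singular[OF E(1)] lf_chain_singular[OF cl] in auto)
  then show ?thesis using E(1) by blast
qed

text \<open>Truncation to \<open>K 0\<close> induces a homomorphism from locally finite cycles to relative homology. It is
  onto by \<open>lf_cycle_extends\<close>, and by \<open>lf_cycle_bounds\<close> its kernel consists of the boundaries of locally
  finite chains. That boundaries form a subgroup is part of the conclusion, because kernels are subgroups.\<close>

theorem BM_homology_iso_relative:
  shows comm_group_BM_homology: "comm_group (BM_homology_group p X)"
    and "BM_homology_group p X \<cong> relative_homology_group (int p) X (S 0)"
proof -
  let ?G = "lf_cycle_group p X" and ?H = "relative_homology_group (int p) X (S 0)"
  let ?t = "truncate_chain p (K 0)"
  let ?h = "\<lambda>c. homologous_rel_set p X (S 0) (?t c)"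
  have t_add: "?t (\<lambda>f. c f + d f) = ?t c + ?t d" if "c \<in> carrier ?G" "d \<in> carrier ?G" for c d
    using that lookup_truncate_chain[OF _ compact[of 0]]
    by (intro poly_mapping_eqI) (auto simp: lf_cycle_carrier lf_chain_set_add lookup_add)
  have mult_H: "homologous_rel_set p X (S 0) a \<otimes>\<^bsub>?H\<^esub> homologous_rel_set p X (S 0) b
      = homologous_rel_set p X (S 0) (a + b)"
    if "singular_relcycle p X (S 0) a" "singular_relcycle p X (S 0) b" for a b
  proof -
    interpret N: normal "singular_relboundary_set p X (S 0)" "relcycle_group p X (S 0)"
      by (rule normal_subgroup_singular_relboundary_relcycle)
    show ?thesis
      using N.rcos_sum[of a b] that
      by (simp add: nontrivial_relative_homology_group FactGroup_def right_coset_singular_relboundary)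
  qed
  have h_hom: "?h \<in> hom ?G ?H"
    using truncate_relcycle[of _ p 0]
    by (auto simp: hom_def carrier_relative_homology_group t_add mult_H)
  interpret group_hom ?G ?H ?h
    by (simp add: group_hom_def group_hom_axioms_def group_lf_cycle_group h_hom)
  have surj: "?h ` carrier ?G = carrier ?H"
  proof
    show "?h ` carrier ?G \<subseteq> carrier ?H" using h_hom by (auto simp: hom_def)
    show "carrier ?H \<subseteq> ?h ` carrier ?G"
    proof
      fix R assume "R \<in> carrier ?H"
      then obtain z where z: "singular_relcycle p X (S 0) z" and R: "R = homologous_rel_set p X (S 0) z"
        by (auto simp: carrier_relative_homology_group)
      then obtain c where c: "c \<in> carrier ?G" "singular_relboundary p X (S 0) (?t c - z)"
        using lf_cycle_extends by blast
      then have "?h c = R"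
        unfolding R homologous_rel_set_eq by (simp only: homologous_rel_def)
      then show "R \<in> ?h ` carrier ?G" using c(1) by (rule rev_image_eqI[OF _ sym, rotated])
    qed
  qed
  have ker: "kernel ?G ?H ?h = lf_boundary (Suc p) ` lf_chain_set (Suc p) X"
  proof
    show "kernel ?G ?H ?h \<subseteq> lf_boundary (Suc p) ` lf_chain_set (Suc p) X"
      using lf_cycle_bounds by (fastforce simp: kernel_def homologous_rel_set_eq_relboundary)
    show "lf_boundary (Suc p) ` lf_chain_set (Suc p) X \<subseteq> kernel ?G ?H ?h"
    proof clarify
      fix e assume e: "e \<in> lf_chain_set (Suc p) X"
      have c: "lf_boundary (Suc p) e \<in> carrier ?G"
        using lf_boundary_in_lf_chain_set[OF e] lf_boundary_boundary[OF e] by (simp add: lf_cycle_carrier)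
      have cl: "lf_boundary (Suc p) e \<in> lf_chain_set p X" using c lf_cycle_carrier by blast
      have "agree_on p (K 0) (Poly_Mapping.lookup (chain_boundary (Suc p) (truncate_chain (Suc p) (K 0) e)))
          (Poly_Mapping.lookup (?t (lf_boundary (Suc p) e)))"
        using agree_on_trans[OF _ agree_on_sym[OF agree_on_truncate[OF cl compact]]]
          agree_on_boundary_truncate[OF e compact, of 0] by simp
      then have "singular_relboundary p X (S 0) (?t (lf_boundary (Suc p) e))"
        unfolding relboundary_avoiding_iff
        using singular_chain_truncate[OF cl compact] singular_chain_truncate[OF e compact] by blast
      then show "lf_boundary (Suc p) e \<in> kernel ?G ?H ?h"
        using c by (simp add: kernel_def homologous_rel_set_eq_relboundary)
    qed
  qed
  show "BM_homology_group p X \<cong> ?H"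
    using FactGroup_iso[OF surj] unfolding BM_homology_group_def ker .
  have "comm_group ?G"
    by (rule group.group_comm_groupI[OF group_lf_cycle_group]) (simp add: add.commute)
  then show "comm_group (BM_homology_group p X)"
    using subgroup_kernel unfolding BM_homology_group_def ker by (rule comm_group.abelian_FactGroup)
qed

end

section \<open>The two ends of a cylinder\<close>

text \<open>All homotopies of a cylinder used in this development move points along the line factor, on a straight
  segment from \<open>\<phi> s\<close> to \<open>s\<close>. The invariance of \<open>C \<times> B\<close> makes them homotopies of pairs.\<close>

lemma homotopic_straight_line_second_factor:
  fixes \<phi> :: "real \<Rightarrow> real"
  assumes \<phi>: "continuous_map euclideanreal euclideanreal \<phi>"
    and B: "\<And>s t. s \<in> B \<Longrightarrow> 0 \<le> t \<Longrightarrow> t \<le> 1 \<Longrightarrow> (1 - t) * \<phi> s + t * s \<in> B"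
  shows "homotopic_with (\<lambda>k. k ` (C \<times> B) \<subseteq> C \<times> B) (prod_topology Y euclideanreal) (prod_topology Y euclideanreal)
           (\<lambda>x. (fst x, \<phi> (snd x))) id"
proof -
  let ?P = "prod_topology Y euclideanreal"
  let ?I = "prod_topology (subtopology euclideanreal {0..1}) ?P"
  define h where "h = (\<lambda>z :: real \<times> 'a \<times> real. (fst (snd z), (1 - fst z) * \<phi> (snd (snd z)) + fst z * snd (snd z)))"
  have fst: "continuous_map ?I euclideanreal fst"
    using continuous_map_fst[of "subtopology euclideanreal {0..1}" ?P] continuous_map_in_subtopology by blast
  have snd: "continuous_map ?I euclideanreal (\<lambda>z. snd (snd z))"
    using continuous_map_compose[OF continuous_map_snd continuous_map_snd] by (simp add: o_def)
  have \<phi>snd: "continuous_map ?I euclideanreal (\<lambda>z. \<phi> (snd (snd z)))"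
    using continuous_map_compose[OF snd \<phi>] by (simp add: o_def)
  have "continuous_map ?I Y (\<lambda>z. fst (snd z))"
    using continuous_map_compose[OF continuous_map_snd continuous_map_fst] by (simp add: o_def)
  moreover have "continuous_map ?I euclideanreal (\<lambda>z. (1 - fst z) * \<phi> (snd (snd z)) + fst z * snd (snd z))"
    by (intro continuous_map_add continuous_map_real_mult continuous_map_diff fst snd \<phi>snd) simp
  ultimately have "continuous_map ?I ?P h"
    by (simp add: h_def continuous_map_pairwise o_def)
  then show ?thesis
    unfolding homotopic_with_def
    by (intro exI[of _ h]) (auto simp: h_def B)
qed

definition cylinder_ends :: "'a topology \<Rightarrow> real \<Rightarrow> ('a \<times> real) set" where
  "cylinder_ends Y a = topspace Y \<times> {s. a < \<bar>s\<bar>}"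

lemma abs_line_scale:
  fixes s t :: real
  assumes "a < \<bar>s\<bar>" "0 \<le> t" "t \<le> 1" "1 \<le> c"
  shows "a < \<bar>(1 - t) * (c * s) + t * s\<bar>"
proof -
  have "1 \<le> (1 - t) * c + t"
    using mult_left_mono[OF assms(4), of "1 - t"] assms(3) by simp
  then have "\<bar>s\<bar> \<le> \<bar>((1 - t) * c + t) * s\<bar>"
    by (simp add: abs_mult mult_le_cancel_right1)
  then show ?thesis using assms(1) by (simp add: algebra_simps)
qed

text \<open>Stretching the line by the factor \<open>b / a\<close> carries the ends \<open>a < \<bar>s\<bar>\<close> into the smaller ends
  \<open>b < \<bar>s\<bar>\<close>, and the straight-line homotopy to the identity stretches by factors of at least \<open>1\<close>
  throughout, so it preserves both pairs of ends. It is therefore an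
  inverse of the inclusion up to homotopy of pairs.\<close>

lemma cylinder_ends_inclusion_iso:
  assumes "0 < a" "a \<le> b"
  shows "hom_induced p (prod_topology Y euclideanreal) (cylinder_ends Y b) (prod_topology Y euclideanreal) (cylinder_ends Y a) id
     \<in> iso (relative_homology_group p (prod_topology Y euclideanreal) (cylinder_ends Y b))
           (relative_homology_group p (prod_topology Y euclideanreal) (cylinder_ends Y a))"
proof -
  let ?P = "prod_topology Y euclideanreal"
  let ?g = "\<lambda>x :: 'a \<times> real. (fst x, b / a * snd x)"
  have c: "1 \<le> b / a" using assms by simp
  have hom: "homotopic_with (\<lambda>k. k \<in> cylinder_ends Y m \<rightarrow> cylinder_ends Y m) ?P ?P ?g id" for m
  proof -
    have "homotopic_with (\<lambda>k. k ` (topspace Y \<times> {s. m < \<bar>s\<bar>}) \<subseteq> topspace Y \<times> {s. m < \<bar>s\<bar>}) ?P ?P ?g id"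
    proof (rule homotopic_straight_line_second_factor)
      show "(1 - t) * (b / a * s) + t * s \<in> {s. m < \<bar>s\<bar>}"
        if "s \<in> {s. m < \<bar>s\<bar>}" "0 \<le> t" "t \<le> 1" for s t
        using abs_line_scale[OF _ that(2,3) c] that(1) by simp
    qed (intro continuous_map_real_mult continuous_map_const[THEN iffD2], simp_all)
    then show ?thesis by (simp add: cylinder_ends_def image_subset_iff_funcset)
  qed
  show ?thesis
  proof (rule homotopy_equivalence_relative_homology_group_isomorphism[where g = ?g])
    show "continuous_map ?P ?P ?g" using homotopic_with_imp_continuous_maps[OF hom] by simp
    show "id \<in> cylinder_ends Y b \<rightarrow> cylinder_ends Y a" using assms by (auto simp: cylinder_ends_def)
    show "?g \<in> cylinder_ends Y a \<rightarrow> cylinder_ends Y b"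
    proof -
      have "b < \<bar>b / a * s\<bar>" if "a < \<bar>s\<bar>" for s
        using mult_strict_left_mono[OF that, of "b / a"] assms by (simp add: abs_mult)
      then show ?thesis by (auto simp: cylinder_ends_def)
    qed
  qed (use hom in \<open>simp_all add: o_def id_def\<close>)
qed

lemma homotopic_with_restrict_invariant:
  assumes "homotopic_with (\<lambda>k. k ` S \<subseteq> S) X X f g"
  shows "homotopic_with (\<lambda>h. True) (subtopology X S) (subtopology X S) f g"
  using assms unfolding homotopic_with_def
  by (rule ex_forward)
     (auto simp: prod_topology_subtopology continuous_map_in_subtopology continuous_map_from_subtopology image_subset_iff)

lemma homology_cylinder_convex_fibre:
  assumes J: "convex J" and a: "a \<in> J"
  shows "homology_group p (subtopology (prod_topology Y euclideanreal) (topspace Y \<times> J)) \<cong> homology_group p Y"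
proof -
  let ?P = "prod_topology Y euclideanreal" and ?S = "topspace Y \<times> J"
  have "homotopic_with (\<lambda>k. k ` ?S \<subseteq> ?S) ?P ?P (\<lambda>x. (fst x, a)) id"
  proof (rule homotopic_straight_line_second_factor)
    show "(1 - t) * a + t * s \<in> J" if "s \<in> J" "0 \<le> t" "t \<le> 1" for s t
      using convexD[OF J a that(1), of "1 - t" t] that by simp
  qed simp
  from homotopic_with_restrict_invariant[OF this]
  have hom: "homotopic_with (\<lambda>h. True) (subtopology ?P ?S) (subtopology ?P ?S) (\<lambda>x. (fst x, a)) id" .
  have "hom_induced p (subtopology ?P ?S) {} Y {} fst
      \<in> iso (homology_group p (subtopology ?P ?S)) (homology_group p Y)"
  proof (rule homotopy_equivalence_homology_group_isomorphism[where g = "\<lambda>y. (y, a)"])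
    show "continuous_map (subtopology ?P ?S) Y fst"
      by (rule continuous_map_from_subtopology) (rule continuous_map_fst)
    show "continuous_map Y (subtopology ?P ?S) (\<lambda>y. (y, a))"
      using a by (auto simp: continuous_map_in_subtopology continuous_map_pairwise o_def)
    show "homotopic_with (\<lambda>h. True) (subtopology ?P ?S) (subtopology ?P ?S) ((\<lambda>y. (y, a)) \<circ> fst) id"
      using hom by (simp add: o_def)
    show "homotopic_with (\<lambda>h. True) Y Y (fst \<circ> (\<lambda>y. (y, a))) id"
      by (simp add: o_def id_def)
  qed
  then show ?thesis by (rule is_isoI)
qed

text \<open>Let \<open>T\<close> be the upper end. The whole cylinder can be pushed into \<open>T\<close>, so the relative homology of the
  cylinder modulo \<open>T\<close> vanishes and the boundary map of the triple is an isomorphism onto the homology of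
  the two ends modulo \<open>T\<close>. Since \<open>T\<close> is open and closed in the union of the ends, it can be excised,
  and only the lower end remains.\<close>

theorem relative_homology_cylinder_ends:
  "relative_homology_group p (prod_topology Y euclideanreal) (cylinder_ends Y 1) \<cong> homology_group (p - 1) Y"
proof -
  let ?P = "prod_topology Y euclideanreal"
  let ?S = "cylinder_ends Y 1" and ?T = "topspace Y \<times> {1<..}"
  have TS: "?T \<subseteq> ?S" by (auto simp: cylinder_ends_def)
  have triv: "trivial_group (relative_homology_group q ?P ?T)" for q
  proof (rule trivial_relative_homology_group_alt)
    \<comment> \<open>The push \<open>s \<mapsto> \<bar>s\<bar> + 2\<close> lands in the upper end, and on that end it is the translation by \<open>2\<close>.\<close>
    have cm: "continuous_map euclideanreal euclideanreal (\<lambda>s. \<bar>s\<bar> + 2 :: real)"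
      by (intro continuous_map_add continuous_map_real_abs) simp_all
    show hom: "homotopic_with (\<lambda>k. k ` ?T \<subseteq> ?T) ?P ?P (\<lambda>x. (fst x, \<bar>snd x\<bar> + 2)) id"
    proof (rule homotopic_straight_line_second_factor[OF cm])
      show "(1 - t) * (\<bar>s\<bar> + 2) + t * s \<in> {1<..}" if "s \<in> {1<..}" "0 \<le> t" "t \<le> 1" for s t :: real
      proof -
        have "(1 - t) * (\<bar>s\<bar> + 2) + t * s = s + 2 * (1 - t)" using that by (simp add: algebra_simps)
        then show ?thesis using that by auto
      qed
    qed
    show "continuous_map ?P (subtopology ?P ?T) (\<lambda>x. (fst x, \<bar>snd x\<bar> + 2))"
      using homotopic_with_imp_continuous_maps[OF hom] by (auto simp: continuous_map_in_subtopology)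
  qed
  have "hom_relboundary p ?P ?S ?T
         \<in> iso (relative_homology_group p ?P ?S) (relative_homology_group (p - 1) (subtopology ?P ?S) ?T)"
  proof (rule very_short_exact_sequence)
    show "exact_seq
         ([relative_homology_group (p - 1) ?P ?T, relative_homology_group (p - 1) (subtopology ?P ?S) ?T, relative_homology_group p ?P ?S, relative_homology_group p ?P ?T],
          [hom_induced (p - 1) (subtopology ?P ?S) ?T ?P ?T id, hom_relboundary p ?P ?S ?T, hom_induced p ?P ?T ?P ?S id])"
      using homology_exactness_triple_1[OF TS, of p ?P] homology_exactness_triple_2[OF TS, of p ?P] by simp
  qed (rule triv)+
  then have 1: "relative_homology_group p ?P ?S \<cong> relative_homology_group (p - 1) (subtopology ?P ?S) ?T"
    by (rule is_isoI)
  let ?R = "subtopology ?P ?S"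
  have T_closed: "closedin ?R ?T"
  proof -
    have "closedin ?P (topspace Y \<times> {0..})" by (simp add: closedin_prod_Times_iff)
    moreover have "?T = (topspace Y \<times> {0..}) \<inter> ?S" by (auto simp: cylinder_ends_def)
    ultimately show ?thesis unfolding closedin_subtopology by blast
  qed
  have T_open: "openin ?R ?T"
  proof -
    have "openin ?P ?T" by (simp add: openin_prod_Times_iff)
    then show ?thesis using TS by (simp add: openin_subset_topspace_eq openin_subtopology) blast
  qed
  have "?R closure_of ?T \<subseteq> ?R interior_of ?T"
    using T_closed T_open by (simp add: closure_of_closedin interior_of_openin)
  from homology_excision_axiom[OF this TS, of "p - 1"]
  have "relative_homology_group (p - 1) (subtopology ?R (?S - ?T)) {} \<cong> relative_homology_group (p - 1) ?R ?T"
    by (intro is_isoI) (simp add: subtopology_subtopology)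
  moreover have "subtopology ?R (?S - ?T) = subtopology ?P (topspace Y \<times> {..<-1})"
  proof -
    have "?S \<inter> (?S - ?T) = topspace Y \<times> {..<-1}" by (auto simp: cylinder_ends_def)
    then show ?thesis by (simp add: subtopology_subtopology)
  qed
  ultimately have 2: "homology_group (p - 1) (subtopology ?P (topspace Y \<times> {..<-1})) \<cong> relative_homology_group (p - 1) ?R ?T"
    by simp
  have 3: "homology_group (p - 1) (subtopology ?P (topspace Y \<times> {..<-1})) \<cong> homology_group (p - 1) Y"
    by (rule homology_cylinder_convex_fibre[of _ "-2"]) simp_all
  from 2 have "relative_homology_group (p - 1) ?R ?T \<cong> homology_group (p - 1) (subtopology ?P (topspace Y \<times> {..<-1}))"
    by (simp add: group.iso_sym)
  with 1 3 show ?thesis using iso_trans by blast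
qed

section \<open>Borel-Moore homology of cylinders\<close>

text \<open>The homeomorphism is applied at the level of relative homology: the images of the sets
  \<open>Y \<times> [-(k+1), k+1]\<close> form an exhaustion of \<open>X\<close>, and its stability follows from that of the ends of the
  cylinder by naturality. The bound
  \<open>k+1\<close> instead of \<open>k\<close> keeps the stretching factors finite.\<close>

theorem BM_homology_cylinder:
  assumes Y: "compact_space Y" and h: "homeomorphic_map (prod_topology Y euclideanreal) X h"
  shows "comm_group (BM_homology_group p X)"
    and "BM_homology_group p X \<cong> homology_group (int p - 1) Y"
proof -
  let ?P = "prod_topology Y euclideanreal"
  define K where "K k = h ` (topspace Y \<times> {- real (Suc k)..real (Suc k)})" for k
  have inj: "inj_on h (topspace ?P)" and surj: "h ` topspace ?P = topspace X"
    and cont: "continuous_map ?P X h"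
    using h by (simp_all add: homeomorphic_eq_everything_map)
  have compl: "topspace X - K k = h ` cylinder_ends Y (real (Suc k))" for k
  proof -
    have "topspace ?P - topspace Y \<times> {- real (Suc k)..real (Suc k)} = cylinder_ends Y (real (Suc k))"
      by (auto simp: cylinder_ends_def)
    then show ?thesis
      unfolding K_def surj[symmetric]
      by (subst inj_on_image_set_diff[OF inj, symmetric]) auto
  qed
  have ends_sub: "cylinder_ends Y a \<subseteq> topspace ?P" for a by (auto simp: cylinder_ends_def)
  let ?H = "\<lambda>q k. relative_homology_group (int q) X (topspace X - K k)"
  have to_X: "hom_induced q ?P (cylinder_ends Y (real (Suc k))) X (topspace X - K k) h
       \<in> iso (relative_homology_group q ?P (cylinder_ends Y (real (Suc k))))
           (relative_homology_group q X (topspace X - K k))" for q k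
    unfolding compl by (rule homeomorphic_map_relative_homology_iso[OF h ends_sub refl])
  interpret homology_stable_exhaustion X K
  proof
    show "compactin X (K k)" for k
      unfolding K_def
      by (rule image_compactin[OF _ cont]) (use Y in \<open>simp add: compactin_Times compact_space_def\<close>)
    show "K k \<subseteq> K (Suc k)" for k
      unfolding K_def by (intro image_mono Sigma_mono) auto
    show "\<exists>k. x \<in> X interior_of K k" if x: "x \<in> topspace X" for x
    proof -
      obtain y s where ys: "y \<in> topspace Y" "x = h (y, s)" using x surj by force
      obtain k where k: "\<bar>s\<bar> < real k" using reals_Archimedean2 by blast
      let ?U = "topspace Y \<times> {- real (Suc k)<..<real (Suc k)}"
      have "openin ?P ?U" by (simp add: openin_prod_Times_iff)
      then have "openin X (h ` ?U)"
        using homeomorphic_map_openness[OF h, of ?U] by auto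
      moreover have "h ` ?U \<subseteq> K k" unfolding K_def by (intro image_mono Sigma_mono) auto
      ultimately have "h ` ?U \<subseteq> X interior_of K k" by (rule interior_of_maximal[rotated])
      moreover have "x \<in> h ` ?U" unfolding ys(2) using ys(1) k by (intro imageI) auto
      ultimately show ?thesis by blast
    qed
    show "bij_betw (hom_induced (int q) X (topspace X - K (Suc k)) X (topspace X - K k) id)
        (carrier (?H q (Suc k))) (carrier (?H q k))" for q k
    proof -
      let ?A = "cylinder_ends Y (real (Suc (Suc k)))" and ?B = "cylinder_ends Y (real (Suc k))"
      let ?i = "hom_induced (int q) ?P ?A ?P ?B id" and ?j = "hom_induced (int q) X (topspace X - K (Suc k)) X (topspace X - K k) id"
      let ?hA = "hom_induced (int q) ?P ?A X (topspace X - K (Suc k)) h" and ?hB = "hom_induced (int q) ?P ?B X (topspace X - K k) h"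
      have sub: "?A \<subseteq> ?B" by (auto simp: cylinder_ends_def)
      have subX: "topspace X - K (Suc k) \<subseteq> topspace X - K k"
        unfolding compl using sub by (rule image_mono)
      have into: "h \<in> ?A \<rightarrow> topspace X - K (Suc k)" "h \<in> ?B \<rightarrow> topspace X - K k"
        unfolding compl by auto
      have natural: "?j \<circ> ?hA = ?hB \<circ> ?i"
      proof -
        have "?j \<circ> ?hA = hom_induced (int q) ?P ?A X (topspace X - K k) (id \<circ> h)"
          using into subX by (intro hom_induced_compose[symmetric] cont continuous_map_id) auto
        also have "\<dots> = ?hB \<circ> ?i"
        proof -
          have "id \<in> ?A \<rightarrow> ?B" using sub by auto
          from hom_induced_compose[OF continuous_map_id this cont into(2), of "int q"]
          show ?thesis by (simp only: id_comp comp_id)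
        qed
        finally show ?thesis .
      qed
      have bij: "bij_betw (?hB \<circ> ?i) (carrier (relative_homology_group (int q) ?P ?A)) (carrier (?H q k))"
        using cylinder_ends_inclusion_iso[of "real (Suc k)" "real (Suc (Suc k))" "int q" Y] to_X[of "int q" k]
        by (intro bij_betw_trans[of _ _ "carrier (relative_homology_group (int q) ?P ?B)"]) (simp_all add: iso_def)
      have "bij_betw ?hA (carrier (relative_homology_group (int q) ?P ?A)) (carrier (?H q (Suc k)))"
        using to_X[of "int q" "Suc k"] by (simp add: iso_def)
      from bij_betw_comp_iff[OF this, of ?j] bij show ?thesis unfolding natural by (rule iffD2)
    qed
  qed
  show "comm_group (BM_homology_group p X)" by (rule comm_group_BM_homology)
  have "BM_homology_group p X \<cong> relative_homology_group (int p) X (topspace X - K 0)"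
    by (rule BM_homology_iso_relative)
  also have "\<dots> \<cong> relative_homology_group (int p) ?P (cylinder_ends Y 1)"
    using is_isoI[OF to_X[of "int p" 0]] by (simp add: group.iso_sym)
  also have "\<dots> \<cong> homology_group (int p - 1) Y"
    by (rule relative_homology_cylinder_ends)
  finally show "BM_homology_group p X \<cong> homology_group (int p - 1) Y" .
qed

lemma ln_homeomorphism: "homeomorphic_maps euclideanreal positive_ray exp ln"
  unfolding homeomorphic_maps_def positive_ray_def
  by (auto simp: continuous_map_in_subtopology intro!: continuous_intros)

text \<open>The exponential function identifies the line with the ray. The shift of degree in
  \<open>BM_homology_cylinder\<close> is multiplication by \<open>fps_X\<close>; the constant coefficient vanishes because homology
  in degree \<open>-1\<close> does.\<close>

theorem BM_poincare_ray_product: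
  assumes Y: "compact_space Y" and X: "prod_topology Y positive_ray homeomorphic_space X"
    and fin: "finite_homology_ranks Y"
  shows "finite_BM_ranks X" "BM_poincare X = fps_X * poincare Y"
proof -
  have "homeomorphic_maps (prod_topology Y euclideanreal) (prod_topology Y positive_ray)
      (\<lambda>(y, s). (id y, exp s)) (\<lambda>(y, s). (id y, ln s))"
    unfolding homeomorphic_maps_prod using ln_homeomorphism homeomorphic_maps_id by blast
  then have "prod_topology Y euclideanreal homeomorphic_space X"
    using X homeomorphic_space_trans homeomorphic_maps_imp_homeomorphic_space by blast
  then obtain h where h: "homeomorphic_map (prod_topology Y euclideanreal) X h"
    using homeomorphic_space by blast
  have rank: "group_rank (BM_homology_group p X) = group_rank (homology_group (int p - 1) Y)" for p
    by (rule group_rank_iso[OF BM_homology_cylinder(1)[OF Y h] abelian_homology_group BM_homology_cylinder(2)[OF Y h]])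
  have rank_0: "group_rank (BM_homology_group 0 X) = 0"
    unfolding rank by (rule group_rank_trivial) simp_all
  have rank_Suc: "group_rank (BM_homology_group (Suc p) X) = group_rank (homology_group (int p) Y)" for p
    using rank[of "Suc p"] by simp
  show "finite_BM_ranks X"
    unfolding finite_BM_ranks_def
  proof
    fix i show "group_rank (BM_homology_group i X) \<noteq> \<infinity>"
      using fin rank_0 rank_Suc by (cases i) (simp_all add: finite_homology_ranks_def zero_enat_def)
  qed
  show "BM_poincare X = fps_X * poincare Y"
  proof (rule fps_ext)
    fix i show "fps_nth (BM_poincare X) i = fps_nth (fps_X * poincare Y) i"
      using rank_0 rank_Suc by (cases i) (simp_all add: BM_poincare_def poincare_def zero_enat_def)
  qed
qed

section \<open>Polar coordinates\<close>

lemma compact_space_nsphere: "compact_space (nsphere k)"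
proof -
  let ?E = "powertop_real UNIV" and ?S = "{x. (\<Sum>i\<le>k. x i ^ 2) = (1 :: real) \<and> (\<forall>i>k. x i = 0)}"
  have "compactin ?E ?S"
  proof (rule closed_compactin)
    show "compactin ?E (UNIV \<rightarrow>\<^sub>E {-1..1 :: real})" by (simp add: compactin_PiE)
    show "?S \<subseteq> UNIV \<rightarrow>\<^sub>E {-1..1}"
    proof
      fix x assume "x \<in> ?S"
      then have "x \<in> topspace (nsphere k)" by (simp add: nsphere)
      then have "(x i)\<^sup>2 \<le> 1" for i by (rule topspace_nsphere_1)
      then show "x \<in> UNIV \<rightarrow>\<^sub>E {-1..1}" by (auto simp: abs_square_le_1 abs_le_iff)
    qed
    have eq: "?S = {x \<in> topspace ?E. (\<Sum>i\<le>k. x i ^ 2) \<in> {1}} \<inter> (\<Inter>i\<in>{k<..}. {x \<in> topspace ?E. x i \<in> {0}})"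
      by auto
    have "closedin ?E {x \<in> topspace ?E. (\<Sum>i\<le>k. x i ^ 2) \<in> {1}}"
      by (rule closedin_continuous_map_preimage[where Y = euclideanreal]) (auto intro!: continuous_intros)
    moreover have "closedin ?E (\<Inter>i\<in>{k<..}. {x \<in> topspace ?E. x i \<in> {0}})"
    proof (rule closedin_Inter)
      show "closedin ?E S" if "S \<in> (\<lambda>i. {x \<in> topspace ?E. x i \<in> {0}}) ` {k<..}" for S
        using that by (elim imageE, hypsubst, intro closedin_continuous_map_preimage[where Y = euclideanreal] continuous_map_product_projection) simp_all
    qed auto
    ultimately show "closedin ?E ?S" unfolding eq by (rule closedin_Int)
  qed
  then show ?thesis by (simp add: nsphere compact_space_subtopology)
qed

theorem polar_homeomorphism:
  "homeomorphic_map (prod_topology (nsphere m) positive_ray) (punctured_space (Suc m)) (\<lambda>(u, r). \<lambda>i. r * u i)"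
proof -
  let ?P = "prod_topology (nsphere m) positive_ray" and ?X = "punctured_space (Suc m)"
  define N where "N x = sqrt (\<Sum>i\<le>m. (x i)\<^sup>2)" for x :: "nat \<Rightarrow> real"
  have X: "?X = subtopology (powertop_real UNIV) {x. (\<forall>i>m. x i = 0) \<and> x \<noteq> (\<lambda>i. 0)}"
    unfolding punctured_space_def Euclidean_space_def subtopology_subtopology
    by (rule arg_cong[where f = "subtopology (powertop_real UNIV)"]) (auto simp: Suc_le_eq)
  have top_X: "topspace ?X = {x. (\<forall>i>m. x i = 0) \<and> x \<noteq> (\<lambda>i. 0)}" by (simp add: X)
  have top_P: "topspace ?P = {x. (\<Sum>i\<le>m. x i ^ 2) = 1 \<and> (\<forall>i>m. x i = 0)} \<times> {0<..}"
    by (simp add: nsphere positive_ray_def)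
  have N_pos: "0 < N x" if x: "x \<in> topspace ?X" for x
  proof -
    obtain i where i: "x i \<noteq> 0" "i \<le> m" using x unfolding top_X by (auto simp: fun_eq_iff not_le[symmetric])
    have "0 < (\<Sum>i\<le>m. (x i)\<^sup>2)" using i by (intro sum_pos2[of _ i]) auto
    then show ?thesis by (simp add: N_def)
  qed
  have N_scale: "N (\<lambda>i. r * u i) = r" if "(u, r) \<in> topspace ?P" for u r
  proof -
    have "0 < r" "(\<Sum>i\<le>m. (u i)\<^sup>2) = 1" using that unfolding top_P by auto
    then show ?thesis unfolding N_def by (simp add: power_mult_distrib sum_distrib_left[symmetric])
  qed
  have unit: "(\<Sum>i\<le>m. (x i / N x)\<^sup>2) = 1" if "x \<in> topspace ?X" for x
  proof -
    have "(\<Sum>i\<le>m. (x i / N x)\<^sup>2) = (\<Sum>i\<le>m. (x i)\<^sup>2) / (N x)\<^sup>2"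
      by (simp add: power_divide sum_divide_distrib)
    also have "(\<Sum>i\<le>m. (x i)\<^sup>2) = (N x)\<^sup>2" by (simp add: N_def sum_nonneg)
    finally show ?thesis using N_pos[OF that] by simp
  qed
  have coord: "continuous_map ?X euclideanreal (\<lambda>x. x i)" for i
    unfolding X by (intro continuous_map_from_subtopology continuous_map_product_projection) simp
  have N_cont: "continuous_map ?X euclideanreal N"
    unfolding N_def by (intro continuous_map_sqrt continuous_map_sum continuous_map_real_pow coord) simp
  have "homeomorphic_maps ?P ?X (\<lambda>(u, r). \<lambda>i. r * u i) (\<lambda>x. (\<lambda>i. x i / N x, N x))"
    unfolding homeomorphic_maps_def
  proof (intro conjI ballI)
    have fst: "continuous_map ?P euclideanreal (\<lambda>z. fst z i)" for i
      using continuous_map_compose[OF continuous_map_fst continuous_map_nsphere_projection] by (simp add: o_def)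
    have snd: "continuous_map ?P euclideanreal snd"
      using continuous_map_snd[of "nsphere m" positive_ray] unfolding positive_ray_def
      by (rule continuous_map_into_fulltopology)
    have "continuous_map ?P (powertop_real UNIV) (\<lambda>z i. snd z * fst z i)"
      unfolding continuous_map_componentwise_UNIV by (intro allI continuous_map_real_mult fst snd)
    moreover have "(\<lambda>i. snd z * fst z i) \<in> {x. (\<forall>i>m. x i = 0) \<and> x \<noteq> (\<lambda>i. 0)}" if "z \<in> topspace ?P" for z
    proof -
      have "fst z \<noteq> (\<lambda>i. 0)" using that unfolding top_P by auto
      then show ?thesis using that unfolding top_P by (auto simp: fun_eq_iff)
    qed
    ultimately show "continuous_map ?P ?X (\<lambda>(u, r). \<lambda>i. r * u i)"
      unfolding X continuous_map_in_subtopology by (simp add: case_prod_unfold image_subset_iff_funcset[symmetric] image_subset_iff)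
    have "continuous_map ?X (powertop_real UNIV) (\<lambda>x i. x i / N x)"
      unfolding continuous_map_componentwise_UNIV
      using N_pos by (intro allI continuous_map_real_divide coord N_cont) (metis less_irrefl)
    then have "continuous_map ?X (nsphere m) (\<lambda>x i. x i / N x)"
      unfolding nsphere continuous_map_in_subtopology using unit by (auto simp: top_X)
    moreover have "continuous_map ?X positive_ray N"
      unfolding positive_ray_def continuous_map_in_subtopology using N_cont N_pos by auto
    ultimately show "continuous_map ?X ?P (\<lambda>x. (\<lambda>i. x i / N x, N x))"
      by (simp add: continuous_map_pairwise o_def)
  next
    fix z assume z: "z \<in> topspace ?P"
    obtain u r where ur: "z = (u, r)" by fastforce
    have "r > 0" using z unfolding ur top_P by simp
    then show "(\<lambda>x. (\<lambda>i. x i / N x, N x)) ((\<lambda>(u, r). \<lambda>i. r * u i) z) = z"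
      using N_scale z by (simp add: ur)
  next
    fix x assume x: "x \<in> topspace ?X"
    then show "(\<lambda>(u, r). \<lambda>i. r * u i) (\<lambda>i. x i / N x, N x) = x"
      using N_pos[OF x] by auto
  qed
  then show ?thesis by (rule homeomorphic_maps_map[THEN iffD1, THEN conjunct1])
qed

lemma point_times_ray: "prod_topology (discrete_topology {()}) positive_ray homeomorphic_space positive_ray"
proof -
  have "homeomorphic_maps (prod_topology (discrete_topology {()}) positive_ray) positive_ray snd (\<lambda>r. ((), r))"
    unfolding homeomorphic_maps_def
    by (auto simp: continuous_map_snd continuous_map_pairwise o_def)
  then show ?thesis by (rule homeomorphic_maps_imp_homeomorphic_space)
qed

theorem proposition14p2:
  fixes n :: nat
  assumes "n \<ge> 1"
  shows "finite_BM_ranks (punctured_space n)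
    \<and> BM_poincare (punctured_space n) = fps_X ^ n + fps_X
    \<and> homeomorphic_map (prod_topology (nsphere (n - 1)) positive_ray) (punctured_space n)
        (\<lambda>(u, r). \<lambda>i. r * u i)
    \<and> finite_homology_ranks (nsphere (n - 1))
    \<and> poincare (nsphere (n - 1)) = 1 + fps_X ^ (n - 1)
    \<and> finite_BM_ranks positive_ray
    \<and> BM_poincare positive_ray = fps_X
    \<and> BM_poincare (punctured_space n) = BM_poincare positive_ray * poincare (nsphere (n - 1))
    \<and> (fps_X ^ n + fps_X :: int fps) = fps_X * (1 + fps_X ^ (n - 1))"
proof -
  obtain m where n: "n = Suc m" using assms by (cases n) auto
  have polar: "homeomorphic_map (prod_topology (nsphere m) positive_ray) (punctured_space n) (\<lambda>(u, r). \<lambda>i. r * u i)"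
    unfolding n by (rule polar_homeomorphism)
  then have "prod_topology (nsphere m) positive_ray homeomorphic_space punctured_space n"
    using homeomorphic_space by blast
  note BM_X = BM_poincare_ray_product[OF compact_space_nsphere this finite_homology_ranks_nsphere]
  have pt: "compact_space (discrete_topology {()})" by (simp add: compact_space_discrete_topology)
  note BM_ray = BM_poincare_ray_product[OF pt point_times_ray finite_homology_ranks_point]
  have factor: "(fps_X ^ n + fps_X :: int fps) = fps_X * (1 + fps_X ^ m)"
    by (simp add: n algebra_simps)
  show ?thesis
    using BM_X BM_ray polar factor
    by (simp add: n finite_homology_ranks_nsphere poincare_nsphere poincare_point)
qed

end
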